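(* Let $m\ge1$ and let $p_i,q_i,r_i$ ($1\le i\le m$) be positive integers. Let $L$ be the oriented link obtained as the closure of the 4-braid on $m$ blocks $\sigma_1^{p_1}\sigma_2^{-q_1}\sigma_3^{r_1}\cdots\sigma_1^{p_m}\sigma_2^{-q_m}\sigma_3^{r_m}$. With $s=-t$ and up to multiplication by a unit, write the Alexander polynomial of $L$ as $\Delta_L(s)=\pm\sum_{i=0}^{d}a_is^i$ with $a_0>0$ and $a_d\neq 0$. Then: (1) if $p_i,q_i,r_i>1$ for all $i$, then $a_0=1$ and $a_1=2m+1$; (2) if $p_i,q_i,r_i>2$ for all $i$, then $a_2=2m^2+4m$; (3) if $p_i,q_i,r_i>3$ for all $i$, then $a_3=\frac23m\left(2m^2+9m+4\right)$.
   Context: $\sigma_1,\sigma_2,\sigma_3$ are the standard generators of the braid group $B_4$; the closure of a braid is oriented with all strands parallel. The Alexander polynomial $\Delta_L(t)\in\mathbb{Z}[t^{\pm1/2}]$ of an oriented link is determined by $\Delta_{\text{unknot}}=1$ and $\Delta_{L_+}(t)-\Delta_{L_-}(t)=(\sqrt t-1/\sqrt t)\,\Delta_{L_0}(t)$. It is normalized by multiplying by a sign and a power of $t^{1/2}$ so that it becomes a polynomial in $t$ with nonzero constant term; it is then rewritten in the variable $s=-t$, so that $\Delta_L(t)=\pm t^{k/2}\sum_{i=0}^{d}a_i(-t)^i$ for some integer $k$. *)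

theory Defs
  imports "HOL-Library.Poly_Mapping" "HOL-Computational_Algebra.Polynomial"
begin

text \<open>
  Oriented links are given by planar diagrams in Morse position, read from bottom to top
  as a list of elementary slices.  At each level the strands are numbered from 0, left to right,
  and their orientations are recorded as a list of Booleans, with \<open>True\<close> for upward.

  \<open>(Cup b, i)\<close> creates a local minimum in front of strand \<open>i\<close>, whose left branch has orientation
  \<open>b\<close>; \<open>(Cap, i)\<close> is a local maximum joining the strands \<open>i\<close> and \<open>i + 1\<close>; \<open>(Cross c, i)\<close> lets
  these strands cross, and \<open>c\<close> says whether the one running from bottom left to top right is the
  overpass.  The orientation of a diagram is thus determined by its minima.
\<close>

datatype piece = Cup bool | Cap | Cross bool

type_synonym slice = "piece \<times> nat"

inductive slice_step :: "bool list \<Rightarrow> slice \<Rightarrow> bool list \<Rightarrow> bool" where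
  cup: "slice_step (u @ v) (Cup b, length u) (u @ [b, \<not> b] @ v)"
| cap: "slice_step (u @ [b, \<not> b] @ v) (Cap, length u) (u @ v)"
| cross: "slice_step (u @ [x, y] @ v) (Cross c, length u) (u @ [y, x] @ v)"

inductive tangle_diagram :: "bool list \<Rightarrow> slice list \<Rightarrow> bool list \<Rightarrow> bool" where
  empty: "tangle_diagram u [] u"
| step: "slice_step u a v \<Longrightarrow> tangle_diagram v D w \<Longrightarrow> tangle_diagram u (a # D) w"

abbreviation link_diagram :: "slice list \<Rightarrow> bool" where
  "link_diagram D \<equiv> tangle_diagram [] D []"

fun inputs :: "piece \<Rightarrow> nat" where
  "inputs (Cup b) = 0"
| "inputs Cap = 2"
| "inputs (Cross c) = 2"

fun outputs :: "piece \<Rightarrow> nat" where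
  "outputs (Cup b) = 2"
| "outputs Cap = 0"
| "outputs (Cross c) = 2"

text \<open>
  The first five rules generate planar isotopy together with the passage of a strand over or under
  a local extremum; the others are the Reidemeister moves.
\<close>

inductive local_move :: "slice list \<Rightarrow> slice list \<Rightarrow> bool" where
  slide: "i \<le> j \<Longrightarrow> local_move [(e, i), (f, j + outputs e)] [(f, j + inputs e), (e, i)]"
| zigzag_right: "local_move [(Cup b, Suc i), (Cap, i)] []"
| zigzag_left: "local_move [(Cup b, i), (Cap, Suc i)] []"
| fork_cap: "local_move [(Cross c, i), (Cap, Suc i)] [(Cross (\<not> c), Suc i), (Cap, i)]"
| fork_cup: "local_move [(Cup b, i), (Cross c, Suc i)] [(Cup b, Suc i), (Cross (\<not> c), i)]"
| R1_right: "local_move [(Cup b, Suc i), (Cross c, i), (Cap, Suc i)] []"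
| R1_left: "local_move [(Cup b, i), (Cross c, Suc i), (Cap, i)] []"
| R2: "local_move [(Cross c, i), (Cross (\<not> c), i)] []"
| R3: "local_move [(Cross c, i), (Cross c, Suc i), (Cross c, i)]
                  [(Cross c, Suc i), (Cross c, i), (Cross c, Suc i)]"

inductive link_move :: "slice list \<Rightarrow> slice list \<Rightarrow> bool" where
  "local_move a b \<Longrightarrow> link_diagram (D @ a @ E) \<Longrightarrow> link_diagram (D @ b @ E)
     \<Longrightarrow> link_move (D @ a @ E) (D @ b @ E)"

definition link_isotopic :: "slice list \<Rightarrow> slice list \<Rightarrow> bool" where
  "link_isotopic = equivclp link_move"

text \<open>
  Below a crossing of strands with orientations \<open>x\<close> and \<open>y\<close>, the orientations read \<open>x, y\<close>, and
  above it \<open>y, x\<close>.  If \<open>x = y\<close>, the crossing is positive iff the strand from bottom left to top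
  right is the overpass, and the oriented smoothing consists of two vertical strands; reversing one
  of the two strands changes the sign and turns the smoothing into a maximum below a minimum.
\<close>

inductive skein_triple :: "slice list \<Rightarrow> slice list \<Rightarrow> slice list \<Rightarrow> bool" where
  "tangle_diagram [] D (u @ [x, y] @ v) \<Longrightarrow> tangle_diagram (u @ [y, x] @ v) E [] \<Longrightarrow>
   skein_triple (D @ [(Cross (x = y), length u)] @ E)
                (D @ [(Cross (x \<noteq> y), length u)] @ E)
                (D @ (if x = y then [] else [(Cap, length u), (Cup y, length u)]) @ E)"

text \<open>
  The group ring of the integers serves as the ring of integer Laurent polynomials in the square
  root of \<open>t\<close>; \<open>t_half k\<close> is \<open>t\<close> to the power \<open>k/2\<close>.
\<close>

type_synonym laurent = "int \<Rightarrow>\<^sub>0 int"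

definition t_half :: "int \<Rightarrow> laurent" where
  "t_half k = Poly_Mapping.single k 1"

definition alexander_polynomial :: "(slice list \<Rightarrow> laurent) \<Rightarrow> bool" where
  "alexander_polynomial \<Delta> \<longleftrightarrow>
     (\<forall>D E. link_isotopic D E \<longrightarrow> \<Delta> D = \<Delta> E) \<and>
     \<Delta> [(Cup True, 0), (Cap, 0)] = 1 \<and>
     (\<forall>P N Z. skein_triple P N Z \<longrightarrow> \<Delta> P - \<Delta> N = (t_half 1 - t_half (-1)) * \<Delta> Z)"

text \<open>\<open>A\<close> is the normalized form of \<open>f\<close> in the variable \<open>s = -t\<close>; as \<open>A\<close> is nonzero, the
  coefficient at its degree does not vanish.\<close>

definition normalized_form :: "laurent \<Rightarrow> int poly \<Rightarrow> bool" where
  "normalized_form f A \<longleftrightarrow> coeff A 0 > 0 \<and>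
     (\<exists>k. \<exists>\<epsilon>\<in>{1, -1}. f = \<epsilon> * t_half k * poly (map_poly of_int A) (- t_half 2))"

text \<open>In a braid word, \<open>(i, True)\<close> stands for the generator \<open>\<sigma>\<^sub>i\<close>, a positive crossing of the
  \<open>i\<close>-th and the next strand, counted from 1, and \<open>(i, False)\<close> for its inverse.\<close>

type_synonym braid_word = "(nat \<times> bool) list"

definition sigma_power :: "nat \<Rightarrow> int \<Rightarrow> braid_word" where
  "sigma_power i k = replicate (nat \<bar>k\<bar>) (i, k > 0)"

definition braid_closure :: "nat \<Rightarrow> braid_word \<Rightarrow> slice list" where
  "braid_closure n w =
     map (\<lambda>i. (Cup True, i)) [0..<n] @
     map (\<lambda>(i, c). (Cross c, i - 1)) w @
     map (\<lambda>i. (Cap, i)) (rev [0..<n])"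

definition block_braid :: "nat \<Rightarrow> (nat \<Rightarrow> nat) \<Rightarrow> (nat \<Rightarrow> nat) \<Rightarrow> (nat \<Rightarrow> nat) \<Rightarrow> braid_word" where
  "block_braid m p q r =
     concat (map (\<lambda>i. sigma_power 1 (int (p i)) @ sigma_power 2 (- int (q i)) @
                      sigma_power 3 (int (r i))) [1..<Suc m])"

end

theory Submission
  imports Defs "HOL-Analysis.Determinants"
begin

text \<open>
  Put \<open>s = -t\<close>. Multiplying each positive crossing by \<open>-t\<^sup>1\<^sup>/\<^sup>2\<close> and each negative one by \<open>t\<^sup>1\<^sup>/\<^sup>2\<close>
  turns the invariant of closed 4-braids into a trace on the Hecke algebra with parameter \<open>s\<close>.
  Such a trace is determined by its values on the products of distinct generators in increasing
  order, where the skein relation and stabilization give 0, except for 1 on the full product.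
  The alternating sum of the traces of the exterior powers of the reduced Burau representation is
  another trace of this kind, so the two agree up to the factor \<open>(1 - s)(1 + s\<^sup>2)\<close>.

  If all exponents are at least \<open>k\<close>, then modulo \<open>s\<^sup>k\<close> the Burau matrix of a block does not depend
  on the exponents. It has rank one and trace \<open>(1 + s\<^sup>2) / (1 - s)\<^sup>2\<close>, while the other exterior
  powers contribute nothing. Hence the Alexander polynomial is congruent to
  \<open>(1 + s\<^sup>2)\<^bsup>m - 1\<^esup> / (1 - s)\<^bsup>2m + 1\<^esup>\<close> modulo \<open>s\<^sup>k\<close>, up to a unit.
\<close>

section \<open>Isotopy of tangle diagrams\<close>

text \<open>With the orientations \<open>u\<close> below and \<open>v\<close> above fixed, the moves
  apply to pieces of a diagram that can be glued afterwards; empty lists give back link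
  isotopy.\<close>

inductive tangle_move :: "bool list \<Rightarrow> bool list \<Rightarrow> slice list \<Rightarrow> slice list \<Rightarrow> bool" for u v where
  "local_move a b \<Longrightarrow> tangle_diagram u (D @ a @ E) v \<Longrightarrow> tangle_diagram u (D @ b @ E) v
     \<Longrightarrow> tangle_move u v (D @ a @ E) (D @ b @ E)"

definition tangle_isotopic :: "bool list \<Rightarrow> bool list \<Rightarrow> slice list \<Rightarrow> slice list \<Rightarrow> bool" where
  "tangle_isotopic u v = equivclp (tangle_move u v)"

lemma tangle_isotopic_link: "tangle_isotopic [] [] = link_isotopic"
proof -
  have "tangle_move [] [] = link_move"
    by (intro ext) (simp add: tangle_move.simps link_move.simps)
  then show ?thesis
    by (simp add: tangle_isotopic_def link_isotopic_def)
qed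

lemma tangle_isotopic_refl [simp]: "tangle_isotopic u v D D"
  by (simp add: tangle_isotopic_def)

lemma tangle_isotopic_sym: "tangle_isotopic u v D E \<Longrightarrow> tangle_isotopic u v E D"
  unfolding tangle_isotopic_def by (rule equivclp_sym)

lemma tangle_isotopic_trans [trans]:
  "tangle_isotopic u v D E \<Longrightarrow> tangle_isotopic u v E F \<Longrightarrow> tangle_isotopic u v D F"
  unfolding tangle_isotopic_def by (rule equivclp_trans)

lemma tangle_diagram_append:
  "tangle_diagram u D v \<Longrightarrow> tangle_diagram v E w \<Longrightarrow> tangle_diagram u (D @ E) w"
  by (induction rule: tangle_diagram.induct) (auto intro: tangle_diagram.intros)

lemma tangle_diagram_single: "slice_step u a v \<Longrightarrow> tangle_diagram u [a] v"
  by (blast intro: tangle_diagram.intros)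

lemma tangle_isotopic_local:
  "local_move a b \<Longrightarrow> tangle_diagram u a v \<Longrightarrow> tangle_diagram u b v \<Longrightarrow> tangle_isotopic u v a b"
  using tangle_move.intros[of a b u "[]" "[]" v]
  by (simp add: tangle_isotopic_def r_into_equivclp)

text \<open>Gluing \<open>A\<close> below and \<open>B\<close> above only enlarges the unchanged
  surroundings of each elementary move, so a chain of moves remains one.\<close>

lemma tangle_isotopic_context:
  assumes "tangle_isotopic u v D E" and A: "tangle_diagram t A u" and B: "tangle_diagram v B w"
  shows "tangle_isotopic t w (A @ D @ B) (A @ E @ B)"
proof -
  have move: "tangle_move t w (A @ D @ B) (A @ E @ B)" if "tangle_move u v D E" for D E
    using that
  proof cases
    case (1 a b D' E')
    have "tangle_diagram t (A @ (D' @ x @ E') @ B) w" if "tangle_diagram u (D' @ x @ E') v" for x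
      using A B that by (blast intro: tangle_diagram_append)
    then show ?thesis
      using 1 tangle_move.intros[of a b t "A @ D'" "E' @ B" w] by simp
  qed
  show ?thesis
    using assms(1) unfolding tangle_isotopic_def
  proof (induction rule: equivclp_induct)
    case base
    then show ?case by simp
  next
    case (step y z)
    then show ?case
      by (meson move equivclp_into_equivclp)
  qed
qed

lemma tangle_isotopic_append:
  assumes "tangle_isotopic u v D D'" "tangle_diagram v E w"
  shows "tangle_isotopic u w (D @ E) (D' @ E)"
  using tangle_isotopic_context[OF assms(1) tangle_diagram.empty assms(2)] by simp

lemma tangle_isotopic_prepend:
  assumes "tangle_isotopic u v D D'" "tangle_diagram t A u"
  shows "tangle_isotopic t v (A @ D) (A @ D')"
  using tangle_isotopic_context[OF assms tangle_diagram.empty] by simp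

section \<open>Computing the orientations along explicit diagrams\<close>

lemma slice_step_cup: "i = length u \<Longrightarrow> slice_step (u @ v) (Cup b, i) (u @ [b, \<not> b] @ v)"
  by (simp add: slice_step.cup del: append.simps)

lemma slice_step_cap: "i = length u \<Longrightarrow> slice_step (u @ [b, \<not> b] @ v) (Cap, i) (u @ v)"
  by (simp add: slice_step.cap del: append.simps)

lemma slice_step_cross: "i = length u \<Longrightarrow> slice_step (u @ [x, y] @ v) (Cross c, i) (u @ [y, x] @ v)"
  by (simp add: slice_step.cross del: append.simps)

text \<open>Meaningful only under \<open>slice_ok\<close>. As a function, it turns the
  well-formedness of an explicit diagram into a simplification.\<close>

fun run_slice :: "bool list \<Rightarrow> slice \<Rightarrow> bool list" where
  "run_slice u (Cup b, i) = take i u @ [b, \<not> b] @ drop i u"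
| "run_slice u (Cap, i) = take i u @ drop (i + 2) u"
| "run_slice u (Cross c, i) = take i u @ [u ! Suc i, u ! i] @ drop (i + 2) u"

fun slice_ok :: "bool list \<Rightarrow> slice \<Rightarrow> bool" where
  "slice_ok u (Cup b, i) \<longleftrightarrow> i \<le> length u"
| "slice_ok u (Cap, i) \<longleftrightarrow> Suc i < length u \<and> u ! Suc i = (\<not> u ! i)"
| "slice_ok u (Cross c, i) \<longleftrightarrow> Suc i < length u"

lemma slice_step_run:
  assumes "slice_ok u (e, i)" "v = run_slice u (e, i)"
  shows "slice_step u (e, i) v"
proof (cases e)
  case (Cup b)
  then show ?thesis
    using slice_step_cup[of i "take i u" "drop i u" b] assms by simp
next
  case Cap
  then have "u = take i u @ [u ! i, \<not> u ! i] @ drop (i + 2) u"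
    using assms(1) Cons_nth_drop_Suc[of i u] Cons_nth_drop_Suc[of "Suc i" u] append_take_drop_id[of i u]
    by simp
  then show ?thesis
    using slice_step_cap[of i "take i u" "u ! i" "drop (i + 2) u"] assms Cap by simp
next
  case (Cross c)
  then have "u = take i u @ [u ! i, u ! Suc i] @ drop (i + 2) u"
    using assms(1) Cons_nth_drop_Suc[of i u] Cons_nth_drop_Suc[of "Suc i" u] append_take_drop_id[of i u]
    by simp
  then show ?thesis
    using slice_step_cross[of i "take i u" "u ! i" "u ! Suc i" "drop (i + 2) u"] assms Cross by simp
qed

lemma tangle_diagram_Cons:
  "slice_ok u a \<Longrightarrow> tangle_diagram (run_slice u a) D v \<Longrightarrow> tangle_diagram u (a # D) v"
  by (metis slice_step_run tangle_diagram.step surj_pair)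

lemma tangle_diagram_Nil: "u = v \<Longrightarrow> tangle_diagram u [] v"
  by (simp add: tangle_diagram.empty)

section \<open>Closed braids\<close>

text \<open>The upward braid strands on the left and the downward return strands of the closure on
  the right.\<close>

definition braid_ends :: "nat \<Rightarrow> bool list" where
  "braid_ends n = replicate n True @ replicate n False"

abbreviation cups :: "nat \<Rightarrow> slice list" where
  "cups n \<equiv> map (\<lambda>i. (Cup True, i)) [0..<n]"

abbreviation caps :: "nat \<Rightarrow> slice list" where
  "caps n \<equiv> map (\<lambda>i. (Cap, i)) (rev [0..<n])"

abbreviation crossings :: "braid_word \<Rightarrow> slice list" where
  "crossings w \<equiv> map (\<lambda>(i, c). (Cross c, i - 1)) w"

definition on_strands :: "nat \<Rightarrow> braid_word \<Rightarrow> bool" where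
  "on_strands n w \<longleftrightarrow> (\<forall>(i, c)\<in>set w. 0 < i \<and> i < n)"

lemma on_strands_simps [simp]:
  "on_strands n []"
  "on_strands n ((i, c) # w) \<longleftrightarrow> 0 < i \<and> i < n \<and> on_strands n w"
  "on_strands n (v @ w) \<longleftrightarrow> on_strands n v \<and> on_strands n w"
  by (auto simp: on_strands_def)

lemma length_braid_ends [simp]: "length (braid_ends n) = 2 * n"
  by (simp add: braid_ends_def)

lemma cup_braid_ends: "slice_step (braid_ends n) (Cup True, n) (braid_ends (Suc n))"
  unfolding braid_ends_def by (rule slice_step_run) (simp_all add: replicate_append_same)

lemma cap_braid_ends: "slice_step (braid_ends (Suc n)) (Cap, n) (braid_ends n)"
  using slice_step_cap[of n "replicate n True" True "replicate n False"]
  by (simp add: braid_ends_def replicate_app_Cons_same)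

text \<open>The two strands are both braid strands or both return strands; they run in the same
  direction, so exchanging them changes no orientation.\<close>

lemma cross_braid_ends:
  assumes "Suc i < n \<or> n \<le> i \<and> Suc i < 2 * n"
  shows "slice_step (braid_ends n) (Cross c, i) (braid_ends n)"
proof (rule slice_step_run)
  show "slice_ok (braid_ends n) (Cross c, i)"
    using assms by auto
  have "braid_ends n ! i = braid_ends n ! Suc i"
    using assms by (auto simp: braid_ends_def nth_append)
  then show "braid_ends n = run_slice (braid_ends n) (Cross c, i)"
    using assms Cons_nth_drop_Suc[of i "braid_ends n"] Cons_nth_drop_Suc[of "Suc i" "braid_ends n"]
      append_take_drop_id[of i "braid_ends n"]
    by auto
qed

lemma cups_diagram: "tangle_diagram [] (cups n) (braid_ends n)"
proof (induction n)
  case 0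
  show ?case by (simp add: braid_ends_def tangle_diagram.empty)
next
  case (Suc n)
  then show ?case
    using cup_braid_ends[of n] by (auto intro: tangle_diagram_append tangle_diagram_single)
qed

lemma caps_diagram: "tangle_diagram (braid_ends n) (caps n) []"
proof (induction n)
  case 0
  show ?case by (simp add: braid_ends_def tangle_diagram.empty)
next
  case (Suc n)
  then show ?case
    using cap_braid_ends[of n] by (auto intro: tangle_diagram.step)
qed

lemma crossings_diagram:
  "on_strands n w \<Longrightarrow> tangle_diagram (braid_ends n) (crossings w) (braid_ends n)"
proof (induction w)
  case (Cons a w)
  then show ?case
    by (cases a) (auto intro!: tangle_diagram.step cross_braid_ends)
qed (auto intro: tangle_diagram.empty)

lemma cups_crossings_diagram:
  "on_strands n w \<Longrightarrow> tangle_diagram [] (cups n @ crossings w) (braid_ends n)"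
  using cups_diagram crossings_diagram by (rule tangle_diagram_append)

lemma crossings_caps_diagram:
  "on_strands n w \<Longrightarrow> tangle_diagram (braid_ends n) (crossings w @ caps n) []"
  using crossings_diagram caps_diagram by (rule tangle_diagram_append)

section \<open>Transport of crossings through the closing arcs\<close>

lemma slide_cross_cross:
  assumes "i + 2 \<le> j" "Suc j < 2 * n" "Suc i < n \<or> n \<le> i" "Suc j < n \<or> n \<le> j"
  shows "tangle_isotopic (braid_ends n) (braid_ends n) [(Cross c, i), (Cross d, j)] [(Cross d, j), (Cross c, i)]"
proof (rule tangle_isotopic_local)
  show "local_move [(Cross c, i), (Cross d, j)] [(Cross d, j), (Cross c, i)]"
    \<comment> \<open>The rule \<open>slide\<close> adds the two outputs of the first slice to the
      position of the second, hence \<open>j - 2\<close>.\<close>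
    using local_move.slide[of i "j - 2" "Cross c" "Cross d"] assms
    by (simp add: Suc_diff_Suc numeral_2_eq_2)
  show "tangle_diagram (braid_ends n) [(Cross c, i), (Cross d, j)] (braid_ends n)"
       "tangle_diagram (braid_ends n) [(Cross d, j), (Cross c, i)] (braid_ends n)"
    using assms by (auto intro!: tangle_diagram.intros cross_braid_ends)
qed

text \<open>A fork move at each of the two minima, with an exchange of their heights in between,
  carries the crossing from the left branches to the right ones. Each fork negates the flag, so
  \<open>c\<close> is restored.\<close>

lemma cross_nested_cups:
  fixes u v :: "bool list"
  defines "k \<equiv> length u"
  shows "tangle_isotopic (u @ v) (u @ [True, True, False, False] @ v)
     [(Cup True, k), (Cup True, Suc k), (Cross c, k)]
     [(Cup True, k), (Cup True, Suc k), (Cross c, k + 2)]"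
    (is "tangle_isotopic ?a ?b _ _")
proof -
  let ?m = "u @ [True, False] @ v"
  note diag = tangle_diagram_Cons tangle_diagram_Nil
  have cup: "tangle_diagram ?a [(Cup True, k)] ?m"
    by (intro diag) (simp_all add: k_def)
  have "tangle_isotopic ?m ?b [(Cup True, Suc k), (Cross c, k)] [(Cup True, k), (Cross (\<not> c), Suc k)]"
    using local_move.fork_cup[of True k "\<not> c"]
    by (intro tangle_isotopic_sym[OF tangle_isotopic_local] diag) (simp_all add: k_def nth_append)
  from tangle_isotopic_prepend[OF this cup]
  have "tangle_isotopic ?a ?b [(Cup True, k), (Cup True, Suc k), (Cross c, k)]
          [(Cup True, k), (Cup True, k), (Cross (\<not> c), Suc k)]" by simp
  also have "tangle_isotopic ?a ?b \<dots> [(Cup True, k), (Cup True, k + 2), (Cross (\<not> c), Suc k)]"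
  proof -
    have "tangle_isotopic ?a (u @ [True, False, True, False] @ v)
            [(Cup True, k), (Cup True, k)] [(Cup True, k), (Cup True, k + 2)]"
      using local_move.slide[of k k "Cup True" "Cup True"]
      by (intro tangle_isotopic_sym[OF tangle_isotopic_local] diag) (simp_all add: k_def nth_append)
    from tangle_isotopic_append[OF this, of "[(Cross (\<not> c), Suc k)]" ?b] show ?thesis
      by (simp add: diag k_def nth_append)
  qed
  also have "tangle_isotopic ?a ?b \<dots> [(Cup True, k), (Cup True, Suc k), (Cross c, k + 2)]"
  proof -
    have "tangle_isotopic ?m ?b [(Cup True, k + 2), (Cross (\<not> c), Suc k)] [(Cup True, Suc k), (Cross c, k + 2)]"
      using local_move.fork_cup[of True "Suc k" c]
      by (intro tangle_isotopic_sym[OF tangle_isotopic_local] diag) (simp_all add: k_def nth_append)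
    from tangle_isotopic_prepend[OF this cup] show ?thesis by simp
  qed
  finally show ?thesis .
qed

lemma cross_nested_caps:
  fixes u v :: "bool list"
  defines "k \<equiv> length u"
  shows "tangle_isotopic (u @ [True, True, False, False] @ v) (u @ v)
     [(Cross c, k), (Cap, Suc k), (Cap, k)]
     [(Cross c, k + 2), (Cap, Suc k), (Cap, k)]"
    (is "tangle_isotopic ?b ?a _ _")
proof -
  let ?m = "u @ [True, False] @ v"
  note diag = tangle_diagram_Cons tangle_diagram_Nil
  have cap: "tangle_diagram ?m [(Cap, k)] ?a"
    by (intro diag) (simp_all add: k_def nth_append)
  have "tangle_isotopic ?b ?m [(Cross c, k), (Cap, Suc k)] [(Cross (\<not> c), Suc k), (Cap, k)]"
    using local_move.fork_cap[of c k]
    by (intro tangle_isotopic_local diag) (simp_all add: k_def nth_append)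
  from tangle_isotopic_append[OF this cap]
  have "tangle_isotopic ?b ?a [(Cross c, k), (Cap, Suc k), (Cap, k)]
          [(Cross (\<not> c), Suc k), (Cap, k), (Cap, k)]" by simp
  also have "tangle_isotopic ?b ?a \<dots> [(Cross (\<not> c), Suc k), (Cap, k + 2), (Cap, k)]"
  proof -
    have "tangle_isotopic (u @ [True, False, True, False] @ v) ?a
            [(Cap, k), (Cap, k)] [(Cap, k + 2), (Cap, k)]"
      using local_move.slide[of k k Cap Cap]
      by (intro tangle_isotopic_local diag) (simp_all add: k_def nth_append)
    from tangle_isotopic_prepend[OF this, of ?b "[(Cross (\<not> c), Suc k)]"] show ?thesis
      by (simp add: diag k_def nth_append)
  qed
  also have "tangle_isotopic ?b ?a \<dots> [(Cross c, k + 2), (Cap, Suc k), (Cap, k)]"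
  proof -
    have "tangle_isotopic ?b ?m [(Cross (\<not> c), Suc k), (Cap, k + 2)] [(Cross c, k + 2), (Cap, Suc k)]"
      using local_move.fork_cap[of "\<not> c" "Suc k"]
      by (intro tangle_isotopic_local diag) (simp_all add: k_def nth_append)
    from tangle_isotopic_append[OF this cap] show ?thesis by simp
  qed
  finally show ?thesis .
qed

lemma braid_ends_Suc_Suc:
  "braid_ends (Suc (Suc k)) = replicate k True @ [True, True, False, False] @ replicate k False"
  by (simp add: braid_ends_def replicate_app_Cons_same)

text \<open>The nested minima pair strand \<open>j\<close> with strand \<open>2 * n - 1 - j\<close>,
  which explains the mirrored position. A crossing away from the two innermost strands first slides
  below the innermost minimum, where induction applies.\<close>

lemma cross_cups:
  assumes "Suc i < n"
  shows "tangle_isotopic [] (braid_ends n) (cups n @ [(Cross c, i)]) (cups n @ [(Cross c, 2 * n - 2 - i)])"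
  using assms
proof (induction n)
  case (Suc n)
  let ?b = "braid_ends n" and ?b' = "braid_ends (Suc n)"
  show ?case
  proof (cases "Suc i = n")
    case True
    then have n: "n = Suc i" by simp
    have "tangle_isotopic (braid_ends i) ?b'
        [(Cup True, i), (Cup True, Suc i), (Cross c, i)] [(Cup True, i), (Cup True, Suc i), (Cross c, i + 2)]"
      using cross_nested_cups[of "replicate i True" "replicate i False" c]
      by (simp add: n braid_ends_Suc_Suc) (simp add: braid_ends_def)
    from tangle_isotopic_prepend[OF this cups_diagram] show ?thesis
      by (simp add: n)
  next
    case False
    with Suc.prems have i: "Suc i < n" by simp
    have cup: "tangle_diagram ?b [(Cup True, n)] ?b'"
      by (intro tangle_diagram_single cup_braid_ends)
    have "tangle_isotopic ?b ?b' [(Cup True, n), (Cross c, i)] [(Cross c, i), (Cup True, n)]"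
      using local_move.slide[of i "n - 2" "Cross c" "Cup True"] i
      by (intro tangle_isotopic_sym[OF tangle_isotopic_local])
        (auto intro!: tangle_diagram.intros cross_braid_ends cup_braid_ends
           simp: Suc_diff_Suc numeral_2_eq_2)
    from tangle_isotopic_prepend[OF this cups_diagram]
    have "tangle_isotopic [] ?b' (cups (Suc n) @ [(Cross c, i)]) ((cups n @ [(Cross c, i)]) @ [(Cup True, n)])"
      by simp
    also have "tangle_isotopic [] ?b' \<dots> ((cups n @ [(Cross c, 2 * n - 2 - i)]) @ [(Cup True, n)])"
      by (rule tangle_isotopic_append[OF Suc.IH[OF i] cup])
    also have "tangle_isotopic [] ?b' \<dots> (cups (Suc n) @ [(Cross c, 2 * Suc n - 2 - i)])"
    proof -
      \<comment> \<open>Above the innermost minimum there are two more strands to the left of the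
        transported crossing.\<close>
      have "2 * n - 2 - i + 2 = 2 * Suc n - 2 - i" "n \<le> 2 * n - 2 - i"
        using i by auto
      then have "local_move [(Cup True, n), (Cross c, 2 * Suc n - 2 - i)] [(Cross c, 2 * n - 2 - i), (Cup True, n)]"
        using local_move.slide[of n "2 * n - 2 - i" "Cup True" "Cross c"] by (simp del: diff_Suc_Suc)
      then have "tangle_isotopic ?b ?b' [(Cross c, 2 * n - 2 - i), (Cup True, n)] [(Cup True, n), (Cross c, 2 * Suc n - 2 - i)]"
        using i
        by (intro tangle_isotopic_sym[OF tangle_isotopic_local])
         (auto intro!: tangle_diagram.intros cross_braid_ends cup_braid_ends)
      from tangle_isotopic_prepend[OF this cups_diagram] show ?thesis by simp
    qed
    finally show ?thesis .
  qed
qed simp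

lemma cross_caps:
  assumes "Suc i < n"
  shows "tangle_isotopic (braid_ends n) [] ((Cross c, i) # caps n) ((Cross c, 2 * n - 2 - i) # caps n)"
  using assms
proof (induction n)
  case (Suc n)
  let ?b = "braid_ends n" and ?b' = "braid_ends (Suc n)"
  show ?case
  proof (cases "Suc i = n")
    case True
    then have n: "n = Suc i" by simp
    have "tangle_isotopic ?b' (braid_ends i)
        [(Cross c, i), (Cap, Suc i), (Cap, i)] [(Cross c, i + 2), (Cap, Suc i), (Cap, i)]"
      using cross_nested_caps[of "replicate i True" "replicate i False" c]
      by (simp add: n braid_ends_Suc_Suc) (simp add: braid_ends_def)
    from tangle_isotopic_append[OF this caps_diagram] show ?thesis
      by (simp add: n)
  next
    case False
    with Suc.prems have i: "Suc i < n" by simp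
    have cap: "tangle_diagram ?b' [(Cap, n)] ?b"
      by (intro tangle_diagram_single cap_braid_ends)
    have "tangle_isotopic ?b' ?b [(Cross c, i), (Cap, n)] [(Cap, n), (Cross c, i)]"
      using local_move.slide[of i "n - 2" "Cross c" Cap] i
      by (intro tangle_isotopic_local)
        (auto intro!: tangle_diagram.intros cross_braid_ends cap_braid_ends
           simp: Suc_diff_Suc numeral_2_eq_2)
    from tangle_isotopic_append[OF this caps_diagram]
    have "tangle_isotopic ?b' [] ((Cross c, i) # caps (Suc n)) ([(Cap, n)] @ ((Cross c, i) # caps n))"
      by simp
    also have "tangle_isotopic ?b' [] \<dots> ([(Cap, n)] @ ((Cross c, 2 * n - 2 - i) # caps n))"
      by (rule tangle_isotopic_prepend[OF Suc.IH[OF i] cap])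
    also have "tangle_isotopic ?b' [] \<dots> ((Cross c, 2 * Suc n - 2 - i) # caps (Suc n))"
    proof -
      have "2 * n - 2 - i + 2 = 2 * Suc n - 2 - i" "n \<le> 2 * n - 2 - i"
        using i by auto
      then have "local_move [(Cap, n), (Cross c, 2 * n - 2 - i)] [(Cross c, 2 * Suc n - 2 - i), (Cap, n)]"
        using local_move.slide[of n "2 * n - 2 - i" Cap "Cross c"] by (simp del: diff_Suc_Suc)
      then have "tangle_isotopic ?b' ?b [(Cap, n), (Cross c, 2 * n - 2 - i)] [(Cross c, 2 * Suc n - 2 - i), (Cap, n)]"
        using i
        by (intro tangle_isotopic_local)
         (auto intro!: tangle_diagram.intros cross_braid_ends cap_braid_ends)
      from tangle_isotopic_append[OF this caps_diagram] show ?thesis by simp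
    qed
    finally show ?thesis .
  qed
qed simp

lemma cross_past_braid:
  assumes "on_strands n w" "n \<le> j" "Suc j < 2 * n"
  shows "tangle_isotopic (braid_ends n) (braid_ends n) ((Cross c, j) # crossings w) (crossings w @ [(Cross c, j)])"
  using assms(1)
proof (induction w)
  case (Cons a w)
  obtain i d where a: "a = (i, d)" by (cases a)
  let ?b = "braid_ends n"
  have i: "0 < i" "i < n" and w: "on_strands n w"
    using Cons.prems by (simp_all add: a)
  have "tangle_isotopic ?b ?b [(Cross c, j), (Cross d, i - 1)] [(Cross d, i - 1), (Cross c, j)]"
    using i assms by (intro tangle_isotopic_sym[OF slide_cross_cross]) auto
  from tangle_isotopic_append[OF this crossings_diagram[OF w]]
  have "tangle_isotopic ?b ?b ((Cross c, j) # crossings (a # w)) ([(Cross d, i - 1)] @ (Cross c, j) # crossings w)"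
    by (simp add: a)
  also have "tangle_isotopic ?b ?b \<dots> ([(Cross d, i - 1)] @ crossings w @ [(Cross c, j)])"
    using i by (intro tangle_isotopic_prepend[OF Cons.IH[OF w]] tangle_diagram_single cross_braid_ends) auto
  finally show ?case by (simp add: a)
qed simp

section \<open>Conjugation and stabilization of closed braids\<close>

lemma braid_closure_context:
  assumes "tangle_isotopic (braid_ends n) (braid_ends n) (crossings a) (crossings b)"
    and "on_strands n u" "on_strands n v"
  shows "link_isotopic (braid_closure n (u @ a @ v)) (braid_closure n (u @ b @ v))"
proof -
  have "tangle_isotopic [] [] ((cups n @ crossings u) @ crossings a @ (crossings v @ caps n))
    ((cups n @ crossings u) @ crossings b @ (crossings v @ caps n))"
    by (rule tangle_isotopic_context[OF assms(1) cups_crossings_diagram[OF assms(2)] crossings_caps_diagram[OF assms(3)]])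
  then show ?thesis
    by (simp add: tangle_isotopic_link braid_closure_def)
qed

text \<open>Conjugation: the lowest crossing passes through the minima to the return strands, rises
  there beside the rest of the braid, and comes back through the maxima as the highest
  crossing.\<close>

lemma braid_closure_rotate1:
  assumes "on_strands n ((i, c) # w)"
  shows "link_isotopic (braid_closure n ((i, c) # w)) (braid_closure n (w @ [(i, c)]))"
proof -
  let ?b = "braid_ends n"
  define j where "j = 2 * n - 2 - (i - 1)"
  have i: "0 < i" "i < n" and w: "on_strands n w"
    using assms by simp_all
  have j: "n \<le> j" "Suc j < 2 * n"
    using i by (auto simp: j_def)
  have "tangle_isotopic [] [] ((cups n @ [(Cross c, i - 1)]) @ (crossings w @ caps n))
    ((cups n @ [(Cross c, j)]) @ (crossings w @ caps n))"
    using i w unfolding j_def by (intro tangle_isotopic_append[OF cross_cups] crossings_caps_diagram) auto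
  also have "(cups n @ [(Cross c, j)]) @ (crossings w @ caps n) =
    cups n @ ((Cross c, j) # crossings w) @ caps n" by simp
  also have "tangle_isotopic [] [] \<dots> (cups n @ (crossings w @ [(Cross c, j)]) @ caps n)"
    by (rule tangle_isotopic_context[OF cross_past_braid[OF w j] cups_diagram caps_diagram])
  also have "cups n @ (crossings w @ [(Cross c, j)]) @ caps n = (cups n @ crossings w) @ ((Cross c, j) # caps n)"
    by simp
  also have "tangle_isotopic [] [] \<dots> ((cups n @ crossings w) @ ((Cross c, i - 1) # caps n))"
    using i w unfolding j_def by (intro tangle_isotopic_prepend[OF tangle_isotopic_sym[OF cross_caps]] cups_crossings_diagram) auto
  finally show ?thesis
    by (simp add: tangle_isotopic_link braid_closure_def)
qed

text \<open>All crossings of \<open>w\<close> lie to the left of the innermost minimum, which can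
  therefore be raised above them.\<close>

lemma braid_cup_commute:
  assumes "on_strands n w"
  shows "tangle_isotopic (braid_ends n) (braid_ends (Suc n)) ((Cup True, n) # crossings w) (crossings w @ [(Cup True, n)])"
  using assms
proof (induction w)
  case (Cons a w)
  obtain i d where a: "a = (i, d)" by (cases a)
  let ?b = "braid_ends n" and ?b' = "braid_ends (Suc n)"
  have i: "0 < i" "i < n" and w: "on_strands n w" and w': "on_strands (Suc n) w"
    using Cons.prems by (auto simp: a on_strands_def)
  have "tangle_isotopic ?b ?b' [(Cup True, n), (Cross d, i - 1)] [(Cross d, i - 1), (Cup True, n)]"
    using local_move.slide[of "i - 1" "n - 2" "Cross d" "Cup True"] i
    by (intro tangle_isotopic_sym[OF tangle_isotopic_local])
        (auto intro!: tangle_diagram.intros cross_braid_ends cup_braid_ends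
           simp: Suc_diff_Suc numeral_2_eq_2)
  from tangle_isotopic_append[OF this crossings_diagram[OF w']]
  have "tangle_isotopic ?b ?b' ((Cup True, n) # crossings (a # w)) ([(Cross d, i - 1)] @ (Cup True, n) # crossings w)"
    by (simp add: a)
  also have "tangle_isotopic ?b ?b' \<dots> ([(Cross d, i - 1)] @ crossings w @ [(Cup True, n)])"
    using i by (intro tangle_isotopic_prepend[OF Cons.IH[OF w]] tangle_diagram_single cross_braid_ends) auto
  finally show ?case by (simp add: a)
qed simp

text \<open>Markov stabilization: once raised above \<open>w\<close>, the innermost minimum forms a
  curl with the last crossing and the innermost maximum, and \<open>R1_right\<close> removes
  it.\<close>

lemma braid_closure_stabilize:
  assumes "on_strands (Suc n) w"
  shows "link_isotopic (braid_closure (Suc (Suc n)) (w @ [(Suc n, c)])) (braid_closure (Suc n) w)"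
proof -
  let ?b = "braid_ends (Suc n)" and ?b' = "braid_ends (Suc (Suc n))"
  have end_diag: "tangle_diagram ?b' [(Cross c, n), (Cap, Suc n)] ?b"
    by (rule tangle_diagram.step[OF cross_braid_ends tangle_diagram_single[OF cap_braid_ends]]) simp
  have "tangle_isotopic [] [] (cups (Suc n) @ ((Cup True, Suc n) # crossings w) @ ([(Cross c, n), (Cap, Suc n)] @ caps (Suc n)))
    (cups (Suc n) @ (crossings w @ [(Cup True, Suc n)]) @ ([(Cross c, n), (Cap, Suc n)] @ caps (Suc n)))"
    by (rule tangle_isotopic_context[OF braid_cup_commute[OF assms] cups_diagram tangle_diagram_append[OF end_diag caps_diagram]])
  also have "(cups (Suc n) @ (crossings w @ [(Cup True, Suc n)]) @ ([(Cross c, n), (Cap, Suc n)] @ caps (Suc n)))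
    = (cups (Suc n) @ crossings w) @ [(Cup True, Suc n), (Cross c, n), (Cap, Suc n)] @ caps (Suc n)" by simp
  also have "tangle_isotopic [] [] \<dots> ((cups (Suc n) @ crossings w) @ [] @ caps (Suc n))"
    by (rule tangle_isotopic_context[OF tangle_isotopic_local[OF local_move.R1_right
          tangle_diagram.step[OF cup_braid_ends end_diag] tangle_diagram.empty]
          cups_crossings_diagram[OF assms] caps_diagram])
  finally show ?thesis
    by (simp add: tangle_isotopic_link braid_closure_def)
qed

section \<open>Traces on the Hecke algebra\<close>

datatype gen = S1 | S2 | S3

type_synonym word4 = "(gen \<times> bool) list"

text \<open>A linear functional on the Hecke algebra with \<open>(T - 1) * (T - s) = 0\<close>,
  given by its values on words. Imposing the relations in every context avoids constructing the
  algebra.\<close>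

definition hecke_functional :: "'a::comm_ring_1 \<Rightarrow> (gen list \<Rightarrow> 'a) \<Rightarrow> bool" where
  "hecke_functional s g \<longleftrightarrow>
     (\<forall>u v i. g (u @ [i, i] @ v) = (1 + s) * g (u @ [i] @ v) - s * g (u @ v)) \<and>
     (\<forall>u v. g (u @ [S1, S2, S1] @ v) = g (u @ [S2, S1, S2] @ v)) \<and>
     (\<forall>u v. g (u @ [S2, S3, S2] @ v) = g (u @ [S3, S2, S3] @ v)) \<and>
     (\<forall>u v. g (u @ [S1, S3] @ v) = g (u @ [S3, S1] @ v))"

text \<open>This allows a subword in the middle of a word to be reduced as if it were the whole
  word.\<close>

lemma hecke_functional_context:
  assumes "hecke_functional s g"
  shows "hecke_functional s (\<lambda>w. g (u @ w @ v))"
  unfolding hecke_functional_def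
proof (intro conjI allI)
  note g = assms[unfolded hecke_functional_def]
  fix a b :: "gen list" and i
  show "g (u @ (a @ [i, i] @ b) @ v) = (1 + s) * g (u @ (a @ [i] @ b) @ v) - s * g (u @ (a @ b) @ v)"
    using g[THEN conjunct1, rule_format, of "u @ a" i "b @ v"] by simp
  show "g (u @ (a @ [S1, S2, S1] @ b) @ v) = g (u @ (a @ [S2, S1, S2] @ b) @ v)"
    using g[THEN conjunct2, THEN conjunct1, rule_format, of "u @ a" "b @ v"] by simp
  show "g (u @ (a @ [S2, S3, S2] @ b) @ v) = g (u @ (a @ [S3, S2, S3] @ b) @ v)"
    using g[THEN conjunct2, THEN conjunct2, THEN conjunct1, rule_format, of "u @ a" "b @ v"] by simp
  show "g (u @ (a @ [S1, S3] @ b) @ v) = g (u @ (a @ [S3, S1] @ b) @ v)"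
    using g[THEN conjunct2, THEN conjunct2, THEN conjunct2, rule_format, of "u @ a" "b @ v"] by simp
qed

lemma hecke_quad:
  assumes "hecke_functional s g" "g (u @ v) = 0" "g (u @ i # v) = 0"
  shows "g (u @ i # i # v) = 0"
  using assms unfolding hecke_functional_def by simp

lemma hecke_S1_S3_commute:
  assumes "hecke_functional s g"
  shows "g (u @ S3 # replicate k S1 @ v) = g (u @ replicate k S1 @ S3 # v)"
proof (induction k arbitrary: u)
  case (Suc k)
  have "g (u @ S3 # S1 # replicate k S1 @ v) = g (u @ S1 # S3 # replicate k S1 @ v)"
    using assms unfolding hecke_functional_def by simp
  also have "\<dots> = g (u @ S1 # replicate k S1 @ S3 # v)"
    using Suc.IH[of "u @ [S1]"] by simp
  finally show ?case by simp
qed simp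

lemma hecke_vanish_S1:
  assumes "hecke_functional s g" "g [] = 0" "g [S1] = 0"
  shows "g (replicate k S1) = 0"
proof (induction k rule: less_induct)
  case (less k)
  consider "k = 0" | "k = 1" | j where "k = Suc (Suc j)"
    by (metis One_nat_def not0_implies_Suc)
  then show ?case
  proof cases
    case 3
    then show ?thesis
      using hecke_quad[OF assms(1), of "[]" "replicate j S1" S1] less.IH[of j] less.IH[of "Suc j"] by simp
  qed (use assms in auto)
qed

lemma hecke_vanish_S1_between:
  assumes "hecke_functional s g" "g (u @ v) = 0" "g (u @ S1 # v) = 0"
  shows "g (u @ replicate k S1 @ v) = 0"
  using hecke_vanish_S1[OF hecke_functional_context[OF assms(1)], of u v] assms(2,3) by simp

lemma replicate_S1: "set w \<subseteq> {S1} \<Longrightarrow> w = replicate (length w) S1"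
  by (metis replicate_eqI singletonD subsetD)

text \<open>Words with at most one \<open>S2\<close> span the subalgebra of \<open>S1\<close> and
  \<open>S2\<close>: the power of \<open>S1\<close> between the last two \<open>S2\<close> reduces
  to exponent 0 or 1, and then the quadratic or the braid relation lowers the number of
  \<open>S2\<close>.\<close>

lemma hecke_vanish_S1_S2:
  assumes "hecke_functional s g"
    and "\<And>k. g (replicate k S1) = 0"
    and "\<And>j k. g (replicate j S1 @ S2 # replicate k S1) = 0"
    and "S3 \<notin> set w"
  shows "g w = 0"
  using assms(4)
proof (induction "count_list w S2" arbitrary: w rule: less_induct)
  case less
  have S1: "set v \<subseteq> {S1}" if "S2 \<notin> set v" "S3 \<notin> set v" for v
    using that gen.exhaust by blast
  show ?case
  proof (cases "S2 \<in> set w")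
    case False
    then show ?thesis
      using S1[of w] replicate_S1[of w] less.prems assms(2) by metis
  next
    case True
    then obtain u b where w: "w = u @ S2 # b" and b: "S2 \<notin> set b"
      by (meson split_list_last)
    have b: "b = replicate (length b) S1"
      using S1[of b] replicate_S1[of b] b less.prems w by simp
    show ?thesis
    proof (cases "S2 \<in> set u")
      case False
      then have "u = replicate (length u) S1"
        using S1[of u] replicate_S1[of u] less.prems w by simp
      then show ?thesis
        using w b assms(3) by metis
    next
      case True
      then obtain u' a where u: "u = u' @ S2 # a" and a: "S2 \<notin> set a"
        by (meson split_list_last)
      have a: "a = replicate (length a) S1"
        using S1[of a] replicate_S1[of a] a less.prems w u by simp
      have small: "g v = 0" if "count_list v S2 < count_list w S2" "S3 \<notin> set v" for v
        using less.hyps that by blast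
      have "g (u' @ S2 # S2 # b) = 0"
        using less.prems by (intro hecke_quad[OF assms(1)] small) (auto simp: w u)
      moreover have "g (u' @ S2 # S1 # S2 # b) = 0"
      proof -
        have "g (u' @ S2 # S1 # S2 # b) = g (u' @ S1 # S2 # S1 # b)"
          using assms(1) unfolding hecke_functional_def by simp
        also have "\<dots> = 0"
          using less.prems by (intro small) (auto simp: w u)
        finally show ?thesis .
      qed
      ultimately have "g ((u' @ [S2]) @ replicate (length a) S1 @ S2 # b) = 0"
        by (intro hecke_vanish_S1_between[OF assms(1)]) auto
      then show ?thesis
        using a by (simp add: w u)
    qed
  qed
qed

text \<open>The same reduction one generator higher. Between the last two \<open>S3\<close> it
  suffices to consider words in \<open>S1\<close> with at most one \<open>S2\<close>; powers of
  \<open>S1\<close> commute with \<open>S3\<close>, leaving \<open>S3 S3\<close> or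
  \<open>S3 S2 S3\<close>.\<close>

lemma hecke_vanish:
  assumes "hecke_functional s g"
    and "\<And>w. S3 \<notin> set w \<Longrightarrow> g w = 0"
    and "\<And>u v. S3 \<notin> set u \<Longrightarrow> S3 \<notin> set v \<Longrightarrow> g (u @ S3 # v) = 0"
  shows "g w = 0"
proof (induction "count_list w S3" arbitrary: w rule: less_induct)
  case less
  show ?case
  proof (cases "S3 \<in> set w")
    case False
    then show ?thesis by (rule assms(2))
  next
    case True
    then obtain u b where w: "w = u @ S3 # b" and b: "S3 \<notin> set b"
      by (meson split_list_last)
    show ?thesis
    proof (cases "S3 \<in> set u")
      case False
      then show ?thesis
        using w b assms(3) by simp
    next
      case True
      then obtain u' a where u: "u = u' @ S3 # a" and a: "S3 \<notin> set a"
        by (meson split_list_last)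
      have small: "g v = 0" if "count_list v S3 < count_list w S3" for v
        using less.hyps that by blast
      let ?h = "\<lambda>a. g ((u' @ [S3]) @ a @ S3 # b)"
      have "?h a = 0"
      proof (rule hecke_vanish_S1_S2[OF hecke_functional_context[OF assms(1)] _ _ a])
        fix j k
        have "?h (replicate k S1) = g ((u' @ replicate k S1) @ S3 # S3 # b)"
          using hecke_S1_S3_commute[OF assms(1), of u' k "S3 # b"] by simp
        also have "\<dots> = 0"
          by (intro hecke_quad[OF assms(1)] small) (auto simp: w u)
        finally show "?h (replicate k S1) = 0" .
        have "?h (replicate j S1 @ S2 # replicate k S1) = g (u' @ S3 # replicate j S1 @ S2 # replicate k S1 @ S3 # b)"
          by simp
        also have "\<dots> = g ((u' @ replicate j S1 @ [S3, S2]) @ replicate k S1 @ S3 # b)"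
          by (subst hecke_S1_S3_commute[OF assms(1)]) simp
        also have "\<dots> = g ((u' @ replicate j S1 @ [S3, S2]) @ S3 # replicate k S1 @ b)"
          by (rule hecke_S1_S3_commute[OF assms(1), symmetric])
        also have "\<dots> = g ((u' @ replicate j S1) @ [S3, S2, S3] @ replicate k S1 @ b)"
          by simp
        also have "\<dots> = g ((u' @ replicate j S1) @ [S2, S3, S2] @ replicate k S1 @ b)"
          using assms(1) unfolding hecke_functional_def by metis
        also have "\<dots> = 0"
          by (intro small) (auto simp: w u)
        finally show "?h (replicate j S1 @ S2 # replicate k S1) = 0" .
      qed
      then show ?thesis
        by (simp add: w u)
    qed
  qed
qed

text \<open>By rotation, powers of \<open>S1\<close> behind \<open>S2\<close> move to the front,
  where they reduce to exponent 0 or 1. What remains are the products of distinct generators in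
  increasing order.\<close>

lemma hecke_trace_vanish:
  assumes g: "hecke_functional s g"
    and trace: "\<And>u v. g (u @ v) = g (v @ u)"
    and base: "g [] = 0" "g [S1] = 0" "g [S2] = 0" "g [S3] = 0"
      "g [S1, S2] = 0" "g [S1, S3] = 0" "g [S2, S3] = 0" "g [S1, S2, S3] = 0"
  shows "g w = 0"
proof (rule hecke_vanish[OF g])
  have S1: "g (replicate k S1 @ v) = 0" if "g v = 0" "g (S1 # v) = 0" for k v
    using hecke_vanish_S1_between[OF g, of "[]" v k] that by simp
  fix w assume w: "S3 \<notin> set w"
  show "g w = 0"
  proof (rule hecke_vanish_S1_S2[OF g _ _ w])
    fix j k
    show "g (replicate k S1) = 0"
      using S1[of "[]"] base by simp
    have "g (replicate j S1 @ S2 # replicate k S1) = g (replicate k S1 @ replicate j S1 @ [S2])"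
      using trace[of "replicate j S1 @ [S2]" "replicate k S1"] by simp
    then show "g (replicate j S1 @ S2 # replicate k S1) = 0"
      using S1[of "[S2]" "k + j"] base by (simp add: replicate_add)
  qed
next
  have S1: "g (replicate k S1 @ v) = 0" if "g v = 0" "g (S1 # v) = 0" for k v
    using hecke_vanish_S1_between[OF g, of "[]" v k] that by simp
  fix u v assume uv: "S3 \<notin> set u" "S3 \<notin> set v"
  \<comment> \<open>Rotation collects both sides of \<open>S3\<close> into one word in
    \<open>S1\<close> and \<open>S2\<close>, reduced with \<open>[S3]\<close> as a fixed
    context.\<close>
  have "g ([] @ (v @ u) @ [S3]) = 0"
  proof (rule hecke_vanish_S1_S2[OF hecke_functional_context[OF g, of "[]" "[S3]"]])
    fix j k
    show "g ([] @ replicate k S1 @ [S3]) = 0"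
      using S1[of "[S3]"] base by simp
    have "g ([] @ (replicate j S1 @ S2 # replicate k S1) @ [S3]) = g ((replicate j S1 @ [S2]) @ S3 # replicate k S1 @ [])"
      by (subst hecke_S1_S3_commute[OF g]) simp
    also have "\<dots> = g (replicate k S1 @ replicate j S1 @ [S2, S3])"
      using trace[of "replicate j S1 @ [S2, S3]" "replicate k S1"] by simp
    also have "\<dots> = 0"
      using S1[of "[S2, S3]" "k + j"] base by (simp add: replicate_add)
    finally show "g ([] @ (replicate j S1 @ S2 # replicate k S1) @ [S3]) = 0" .
  qed (use uv in simp)
  then show "g (u @ S3 # v) = 0"
    using trace[of "u @ [S3]" v] by simp
qed

text \<open>The letter \<open>(i, False)\<close> stands for \<open>s\<close> times the inverse of a
  generator, which equals \<open>1 + s - T\<close>; this makes sense even if \<open>s\<close> is not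
  invertible.\<close>

locale hecke_trace =
  fixes s :: "'a::comm_ring_1" and f :: "word4 \<Rightarrow> 'a"
  assumes skein: "f (u @ (i, True) # v) + f (u @ (i, False) # v) = (1 + s) * f (u @ v)"
    and inverse: "f (u @ (i, True) # (i, False) # v) = s * f (u @ v)"
    and braid12: "f (u @ [(S1, True), (S2, True), (S1, True)] @ v) = f (u @ [(S2, True), (S1, True), (S2, True)] @ v)"
    and braid23: "f (u @ [(S2, True), (S3, True), (S2, True)] @ v) = f (u @ [(S3, True), (S2, True), (S3, True)] @ v)"
    and commute13: "f (u @ [(S1, True), (S3, True)] @ v) = f (u @ [(S3, True), (S1, True)] @ v)"
    and cyclic: "f (u @ v) = f (v @ u)"
begin

text \<open>Positive words are covered by \<open>hecke_trace_vanish\<close>; \<open>skein\<close>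
  then removes the negative letters one at a time.\<close>

lemma vanish:
  assumes base: "\<And>p. p \<in> {[], [S1], [S2], [S3], [S1, S2], [S1, S3], [S2, S3], [S1, S2, S3]} \<Longrightarrow>
      f (map (\<lambda>i. (i, True)) p) = 0"
  shows "f w = 0"
proof -
  let ?pos = "map (\<lambda>i. (i, True)) :: gen list \<Rightarrow> word4"
  have "hecke_functional s (\<lambda>p. f (?pos p))"
    unfolding hecke_functional_def
  proof (intro conjI allI)
    fix u v and i
    show "f (?pos (u @ [S1, S2, S1] @ v)) = f (?pos (u @ [S2, S1, S2] @ v))"
      using braid12[of "?pos u" "?pos v"] by simp
    show "f (?pos (u @ [S2, S3, S2] @ v)) = f (?pos (u @ [S3, S2, S3] @ v))"
      using braid23[of "?pos u" "?pos v"] by simp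
    show "f (?pos (u @ [S1, S3] @ v)) = f (?pos (u @ [S3, S1] @ v))"
      using commute13[of "?pos u" "?pos v"] by simp
    show "f (?pos (u @ [i, i] @ v)) = (1 + s) * f (?pos (u @ [i] @ v)) - s * f (?pos (u @ v))"
      using skein[of "?pos u @ [(i, True)]" i "?pos v"] inverse[of "?pos u" i "?pos v"]
      by (simp add: algebra_simps)
  qed
  then have pos: "f (?pos p) = 0" for p
  proof (rule hecke_trace_vanish)
    show "f (?pos (u @ v)) = f (?pos (v @ u))" for u v
      using cyclic[of "?pos u" "?pos v"] by simp
  qed (rule base, simp)+
  have "f (?pos p @ w) = 0" for p
  proof (induction w arbitrary: p)
    case (Cons a w)
    obtain i c where a: "a = (i, c)" by (cases a)
    have T: "f (?pos p @ (i, True) # w) = 0"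
      using Cons.IH[of "p @ [i]"] by simp
    show ?case
      using T skein[of "?pos p" i w] Cons.IH[of p] by (cases c) (simp_all add: a)
  qed (simp add: pos)
  from this[of "[]"] show ?thesis by simp
qed

end

lemma hecke_trace_linear:
  assumes "hecke_trace s f" "hecke_trace s g"
  shows "hecke_trace s (\<lambda>w. a * f w + b * g w)"
proof -
  interpret f: hecke_trace s f by fact
  interpret g: hecke_trace s g by fact
  show ?thesis
  proof
    fix u v :: word4 and i
    have "a * f (u @ (i, True) # v) + b * g (u @ (i, True) # v) +
        (a * f (u @ (i, False) # v) + b * g (u @ (i, False) # v)) =
        a * (f (u @ (i, True) # v) + f (u @ (i, False) # v)) + b * (g (u @ (i, True) # v) + g (u @ (i, False) # v))"
      by (simp add: algebra_simps)
    also have "\<dots> = (1 + s) * (a * f (u @ v) + b * g (u @ v))"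
      unfolding f.skein g.skein by (simp add: algebra_simps)
    finally show "a * f (u @ (i, True) # v) + b * g (u @ (i, True) # v) +
        (a * f (u @ (i, False) # v) + b * g (u @ (i, False) # v)) = (1 + s) * (a * f (u @ v) + b * g (u @ v))" .
    show "a * f (u @ (i, True) # (i, False) # v) + b * g (u @ (i, True) # (i, False) # v) =
       s * (a * f (u @ v) + b * g (u @ v))"
      unfolding f.inverse g.inverse by (simp add: algebra_simps)
    show "a * f (u @ v) + b * g (u @ v) = a * f (v @ u) + b * g (v @ u)"
      using f.cyclic[of u v] g.cyclic[of u v] by simp
  qed (simp_all add: f.braid12[simplified] g.braid12[simplified] f.braid23[simplified] g.braid23[simplified]
         f.commute13[simplified] g.commute13[simplified])
qed

section \<open>The Burau representation\<close>

definition mat3 :: "'a \<Rightarrow> 'a \<Rightarrow> 'a \<Rightarrow> 'a \<Rightarrow> 'a \<Rightarrow> 'a \<Rightarrow> 'a \<Rightarrow> 'a \<Rightarrow> 'a \<Rightarrow> ('a::comm_ring_1)^3^3" where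
  "mat3 a b c d e f g h k = vector [vector [a, b, c], vector [d, e, f], vector [g, h, k]]"

lemma mat3_simps:
  "mat x = mat3 x 0 0 0 x 0 0 0 x"
  "mat3 a b c d e f g h k + mat3 a' b' c' d' e' f' g' h' k' =
    mat3 (a + a') (b + b') (c + c') (d + d') (e + e') (f + f') (g + g') (h + h') (k + k')"
  "mat3 a b c d e f g h k - mat3 a' b' c' d' e' f' g' h' k' =
    mat3 (a - a') (b - b') (c - c') (d - d') (e - e') (f - f') (g - g') (h - h') (k - k')"
  "mat3 a b c d e f g h k ** mat3 a' b' c' d' e' f' g' h' k' =
    mat3 (a * a' + b * d' + c * g') (a * b' + b * e' + c * h') (a * c' + b * f' + c * k')
      (d * a' + e * d' + f * g') (d * b' + e * e' + f * h') (d * c' + e * f' + f * k')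
      (g * a' + h * d' + k * g') (g * b' + h * e' + k * h') (g * c' + h * f' + k * k')"
  "trace (mat3 a b c d e f g h k) = a + e + k"
  "mat3 a b c d e f g h k = mat3 a' b' c' d' e' f' g' h' k' \<longleftrightarrow>
    a = a' \<and> b = b' \<and> c = c' \<and> d = d' \<and> e = e' \<and> f = f' \<and> g = g' \<and> h = h' \<and> k = k'"
  by (auto simp: mat3_def vec_eq_iff forall_3 sum_3 matrix_matrix_mult_def mat_def trace_def)

text \<open>
  These matrices represent multiples \<open>e\<^sub>i\<close> of the Temperley-Lieb generators: \<open>e\<^sub>i\<^sup>2 = (1 - s) e\<^sub>i\<close>,
  \<open>e\<^sub>i e\<^sub>j e\<^sub>i = -s e\<^sub>i\<close> for neighbours \<open>i\<close>, \<open>j\<close>, and \<open>e\<^sub>1 e\<^sub>3 = 0\<close>.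
\<close>

fun temperley :: "'a::comm_ring_1 \<Rightarrow> gen \<Rightarrow> 'a^3^3" where
  "temperley s S1 = mat3 (1 - s) 1 0 0 0 0 0 0 0"
| "temperley s S2 = mat3 0 0 0 (- s) (1 - s) (- s) 0 0 0"
| "temperley s S3 = mat3 0 0 0 0 0 0 0 1 (1 - s)"

text \<open>As \<open>e\<^sub>i\<close> has square \<open>(1 - s) e\<^sub>i\<close>, the two
  matrices have sum \<open>1 + s\<close> and product \<open>s\<close>, in accordance with
  \<open>skein\<close> and \<open>inverse\<close>.\<close>

fun burau_letter :: "'a::comm_ring_1 \<Rightarrow> gen \<times> bool \<Rightarrow> 'a^3^3" where
  "burau_letter s (i, c) = (if c then mat 1 - temperley s i else mat s + temperley s i)"

fun burau :: "'a::comm_ring_1 \<Rightarrow> word4 \<Rightarrow> 'a^3^3" where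
  "burau s [] = mat 1"
| "burau s (a # w) = burau_letter s a ** burau s w"

lemma burau_append: "burau s (u @ v) = burau s u ** burau s v"
  by (induction u) (simp_all add: matrix_mul_assoc)

lemma burau_letter_add: "burau_letter s (i, True) + burau_letter s (i, False) = mat (1 + s)"
  by (cases i) (simp_all add: mat3_simps)

lemma burau_letter_inverse: "burau_letter s (i, c) ** burau_letter s (i, \<not> c) = mat s"
  by (cases i; cases c) (simp_all add: mat3_simps algebra_simps)

lemma burau_letter_braid12:
  "burau_letter s (S1, c) ** burau_letter s (S2, c) ** burau_letter s (S1, c) =
   burau_letter s (S2, c) ** burau_letter s (S1, c) ** burau_letter s (S2, c)"
  by (cases c) (simp_all add: mat3_simps algebra_simps)

lemma burau_letter_braid23:
  "burau_letter s (S2, c) ** burau_letter s (S3, c) ** burau_letter s (S2, c) =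
   burau_letter s (S3, c) ** burau_letter s (S2, c) ** burau_letter s (S3, c)"
  by (cases c) (simp_all add: mat3_simps algebra_simps)

lemma burau_letter_commute13:
  "burau_letter s (S1, c) ** burau_letter s (S3, c) = burau_letter s (S3, c) ** burau_letter s (S1, c)"
  by (cases c) (simp_all add: mat3_simps algebra_simps)

lemma mat_mult: "mat x ** (A :: 'a::comm_ring_1^'n^'n) = (\<chi> i j. x * A $ i $ j)"
  by (simp add: vec_eq_iff matrix_matrix_mult_def mat_def if_distrib if_distribR sum.delta cong: if_cong)

lemma trace_mat_mult: "trace (mat x ** (A :: 'a::comm_ring_1^'n^'n)) = x * trace A"
  by (simp add: mat_mult trace_def sum_distrib_left)

lemma trace_mult_mat_mult: "trace (A ** (mat x ** B)) = x * trace (A ** (B :: 'a::comm_ring_1^'n^'n))"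
proof -
  have "trace (A ** (mat x ** B)) = trace (mat x ** (B ** A))"
    using trace_mul_sym[of A "mat x ** B"] by (simp add: matrix_mul_assoc)
  also have "\<dots> = x * trace (A ** B)"
    by (simp add: trace_mat_mult trace_mul_sym[of A B])
  finally show ?thesis .
qed

text \<open>The trace of the trivial representation: generators act as 1, and a negative letter,
  being \<open>s\<close> times an inverse, acts as \<open>s\<close>.\<close>

definition neg_weight :: "'a::comm_ring_1 \<Rightarrow> word4 \<Rightarrow> 'a" where
  "neg_weight s w = s ^ length (filter (\<lambda>a. \<not> snd a) w)"

text \<open>The terms of degree 0 and 1 in the alternating sum over the exterior powers.\<close>

definition half_trace :: "'a::comm_ring_1 \<Rightarrow> word4 \<Rightarrow> 'a" where
  "half_trace s w = neg_weight s w - trace (burau s w)"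

lemma matrix_mult_add_rdistrib: "(A + B) ** (C :: 'a::comm_ring_1^'n^'m) = A ** C + B ** C"
  by (simp add: vec_eq_iff matrix_matrix_mult_def sum.distrib distrib_right)

lemma half_trace_skein:
  "half_trace s (u @ (i, True) # v) + half_trace s (u @ (i, False) # v) = (1 + s) * half_trace s (u @ v)"
proof -
  have "trace (burau s (u @ (i, True) # v)) + trace (burau s (u @ (i, False) # v)) =
      trace (burau s u ** ((burau_letter s (i, True) + burau_letter s (i, False)) ** burau s v))"
    by (simp add: burau_append matrix_add_ldistrib matrix_mult_add_rdistrib trace_add del: burau_letter.simps)
  also have "\<dots> = (1 + s) * trace (burau s (u @ v))"
    by (simp only: burau_letter_add trace_mult_mat_mult burau_append)
  finally show ?thesis
    by (simp add: half_trace_def neg_weight_def algebra_simps power_add del: burau.simps)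
qed

lemma half_trace_inverse:
  "half_trace s (u @ (i, c) # (i, \<not> c) # v) = s * half_trace s (u @ v)"
proof -
  have "trace (burau s (u @ (i, c) # (i, \<not> c) # v)) =
      trace (burau s u ** ((burau_letter s (i, c) ** burau_letter s (i, \<not> c)) ** burau s v))"
    by (simp add: burau_append matrix_mul_assoc del: burau_letter.simps)
  also have "\<dots> = s * trace (burau s (u @ v))"
    by (simp only: burau_letter_inverse trace_mult_mat_mult burau_append)
  finally show ?thesis
    by (simp add: half_trace_def neg_weight_def algebra_simps power_add del: burau.simps)
qed

lemma half_trace_cong:
  assumes "burau s a = burau s b" "neg_weight s a = neg_weight s b"
  shows "half_trace s (u @ a @ v) = half_trace s (u @ b @ v)"
  using assms by (simp add: half_trace_def burau_append neg_weight_def power_add)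

lemma half_trace_cyclic: "half_trace s (u @ v) = half_trace s (v @ u)"
  using trace_mul_sym[of "burau s u" "burau s v"]
  by (simp add: half_trace_def burau_append neg_weight_def power_add mult.commute)

text \<open>Exchanging \<open>T\<close> with \<open>1 + s - T\<close> is an automorphism of the
  Hecke algebra.\<close>

definition flip :: "word4 \<Rightarrow> word4" where
  "flip w = map (\<lambda>(i, c). (i, \<not> c)) w"

lemma flip_simps [simp]:
  "flip [] = []" "flip ((i, c) # w) = (i, \<not> c) # flip w" "flip (u @ v) = flip u @ flip v"
  by (simp_all add: flip_def)

lemma half_trace_relations:
  "half_trace s (u @ [(S1, c), (S2, c), (S1, c)] @ v) = half_trace s (u @ [(S2, c), (S1, c), (S2, c)] @ v)"
  "half_trace s (u @ [(S2, c), (S3, c), (S2, c)] @ v) = half_trace s (u @ [(S3, c), (S2, c), (S3, c)] @ v)"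
  "half_trace s (u @ [(S1, c), (S3, c)] @ v) = half_trace s (u @ [(S3, c), (S1, c)] @ v)"
  using burau_letter_braid12[of s c] burau_letter_braid23[of s c] burau_letter_commute13[of s c]
  by (intro half_trace_cong; simp add: matrix_mul_assoc neg_weight_def del: burau_letter.simps)+

lemma hecke_trace_half_trace: "hecke_trace s (half_trace s)"
  by (rule hecke_trace.intro)
    (use half_trace_skein half_trace_inverse[of s _ _ True] half_trace_cyclic half_trace_relations[of s _ True]
      in \<open>simp_all only: not_True_eq_False\<close>)

lemma hecke_trace_half_trace_flip: "hecke_trace s (\<lambda>w. half_trace s (flip w))"
proof
  fix u v :: word4 and i
  show "half_trace s (flip (u @ (i, True) # v)) + half_trace s (flip (u @ (i, False) # v)) =
      (1 + s) * half_trace s (flip (u @ v))"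
    using half_trace_skein[of s "flip u" i "flip v"] by (simp add: add.commute)
  show "half_trace s (flip (u @ (i, True) # (i, False) # v)) = s * half_trace s (flip (u @ v))"
    using half_trace_inverse[of s "flip u" i False "flip v"] by simp
  show "half_trace s (flip (u @ v)) = half_trace s (flip (v @ u))"
    using half_trace_cyclic[of s "flip u" "flip v"] by simp
qed (use half_trace_relations[of s "flip _" False "flip _"] in simp_all)

text \<open>
  The exterior square of the reduced Burau representation amounts to exchanging the matrices of the
  two kinds of letters, and likewise the exterior cube arises from the trivial representation.
\<close>

definition burau_trace :: "'a::comm_ring_1 \<Rightarrow> word4 \<Rightarrow> 'a" where
  "burau_trace s w = half_trace s w - half_trace s (flip w)"

lemma hecke_trace_burau_trace: "hecke_trace s (burau_trace s)"
  using hecke_trace_linear[OF hecke_trace_half_trace hecke_trace_half_trace_flip, of s 1 "- 1"]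
  by (simp add: burau_trace_def [abs_def])

lemma burau_trace_single: "burau_trace s [(i, True)] = 0"
  by (cases i) (simp_all add: burau_trace_def half_trace_def neg_weight_def mat3_simps algebra_simps)

text \<open>For \<open>s = -t\<close> the last value is \<open>1 + t + t^2 + t^3\<close>, the
  classical factor between the Alexander polynomial and the determinant of the identity minus the
  reduced Burau matrix.\<close>

lemma burau_trace_base:
  "burau_trace s [] = 0"
  "burau_trace s [(S1, True), (S2, True)] = 0"
  "burau_trace s [(S1, True), (S3, True)] = 0"
  "burau_trace s [(S2, True), (S3, True)] = 0"
  "burau_trace s [(S1, True), (S2, True), (S3, True)] = (1 - s) * (1 + s\<^sup>2)"
  by (simp_all add: burau_trace_def half_trace_def neg_weight_def mat3_simps algebra_simps power2_eq_square power3_eq_cube)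

section \<open>The Alexander polynomial of a closed 4-braid\<close>

lemma t_half_mult: "t_half j * t_half k = t_half (j + k)"
  by (simp add: t_half_def mult_single)

lemma t_half_0: "t_half 0 = 1"
  by (simp add: t_half_def)

text \<open>Both strands at a braid crossing run upwards, so the oriented smoothing simply deletes
  the letter.\<close>

lemma skein_triple_braid_closure:
  assumes "on_strands n (u @ (i, True) # v)"
  shows "skein_triple (braid_closure n (u @ (i, True) # v)) (braid_closure n (u @ (i, False) # v))
           (braid_closure n (u @ v))"
proof -
  have i: "0 < i" "i < n" and uv: "on_strands n u" "on_strands n v"
    using assms by simp_all
  let ?a = "replicate (i - 1) True" and ?b = "replicate (n - i - 1) True @ replicate n False"
  have "replicate n True = ?a @ [True, True] @ replicate (n - i - 1) True"
    using i by (intro nth_equalityI) (auto simp: nth_append nth_Cons split: nat.split)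
  then have ends: "braid_ends n = ?a @ [True, True] @ ?b"
    by (simp add: braid_ends_def)
  show ?thesis
    using skein_triple.intros[of "cups n @ crossings u" ?a True True ?b "crossings v @ caps n"]
      cups_crossings_diagram[OF uv(1)] crossings_caps_diagram[OF uv(2)]
    by (simp add: ends[symmetric, simplified] braid_closure_def)
qed

lemma braid_closure_local_move:
  assumes "local_move (crossings a) (crossings b)" "on_strands n (u @ a @ v)" "on_strands n b"
  shows "link_isotopic (braid_closure n (u @ a @ v)) (braid_closure n (u @ b @ v))"
  using assms by (intro braid_closure_context tangle_isotopic_local crossings_diagram) simp_all

section \<open>The rescaled invariant on words in three generators\<close>

fun gen_index :: "gen \<Rightarrow> nat" where
  "gen_index S1 = 1" | "gen_index S2 = 2" | "gen_index S3 = 3"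

definition braid_of :: "word4 \<Rightarrow> braid_word" where
  "braid_of w = map (\<lambda>(i, c). (gen_index i, c)) w"

lemma gen_index_bounds: "0 < gen_index i" "gen_index i < 4"
  by (cases i; simp)+

lemma braid_of_simps [simp]:
  "braid_of [] = []" "braid_of ((i, c) # w) = (gen_index i, c) # braid_of w"
  "braid_of (u @ v) = braid_of u @ braid_of v"
  by (simp_all add: braid_of_def)

lemma on_strands_braid_of [simp]: "on_strands 4 (braid_of w)"
  by (auto simp: on_strands_def braid_of_def gen_index_bounds)

definition letter_unit :: "gen \<times> bool \<Rightarrow> laurent" where
  "letter_unit a = (if snd a then - t_half 1 else t_half 1)"

definition word_unit :: "word4 \<Rightarrow> laurent" where
  "word_unit w = prod_list (map letter_unit w)"

lemma word_unit_append: "word_unit (u @ v) = word_unit u * word_unit v"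
  by (simp add: word_unit_def)

context
  fixes \<Delta> :: "slice list \<Rightarrow> laurent"
  assumes \<Delta>: "alexander_polynomial \<Delta>"
begin

lemma alexander_isotopic: "link_isotopic D E \<Longrightarrow> \<Delta> D = \<Delta> E"
  using \<Delta> unfolding alexander_polynomial_def by blast

lemma alexander_skein:
  "on_strands n (u @ (i, True) # v) \<Longrightarrow>
   \<Delta> (braid_closure n (u @ (i, True) # v)) - \<Delta> (braid_closure n (u @ (i, False) # v)) =
     (t_half 1 - t_half (-1)) * \<Delta> (braid_closure n (u @ v))"
  using \<Delta> skein_triple_braid_closure unfolding alexander_polynomial_def by blast

lemma alexander_rotate:
  assumes "on_strands n (u @ v)"
  shows "\<Delta> (braid_closure n (u @ v)) = \<Delta> (braid_closure n (v @ u))"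
  using assms
proof (induction u arbitrary: v)
  case (Cons a u)
  have "\<Delta> (braid_closure n (a # u @ v)) = \<Delta> (braid_closure n ((u @ v) @ [a]))"
    using Cons.prems braid_closure_rotate1[of n "fst a" "snd a" "u @ v"]
    by (intro alexander_isotopic) (cases a, simp)
  also have "\<dots> = \<Delta> (braid_closure n ((v @ [a]) @ u))"
    using Cons.IH[of "v @ [a]"] Cons.prems by (cases a) simp
  finally show ?case by simp
qed simp

lemma alexander_stabilize:
  "on_strands (Suc n) w \<Longrightarrow>
   \<Delta> (braid_closure (Suc (Suc n)) (w @ [(Suc n, c)])) = \<Delta> (braid_closure (Suc n) w)"
  by (intro alexander_isotopic braid_closure_stabilize)

text \<open>If changing a crossing does not affect the invariant, the skein relation gives 0 as the
  product of the smoothed value and a nonzero element of an integral domain.\<close>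

lemma alexander_zero:
  assumes "on_strands n (u @ (i, True) # v)"
    and "\<Delta> (braid_closure n (u @ (i, True) # v)) = \<Delta> (braid_closure n (u @ (i, False) # v))"
  shows "\<Delta> (braid_closure n (u @ v)) = 0"
proof -
  have "t_half 1 - t_half (-1) \<noteq> 0"
    unfolding t_half_def right_minus_eq
    by (metis lookup_single_eq lookup_single_not_eq one_neq_neg_one zero_neq_one)
  then show ?thesis
    using alexander_skein[OF assms(1)] assms(2) by simp
qed

definition scaled_alexander :: "word4 \<Rightarrow> laurent" where
  "scaled_alexander w = word_unit w * \<Delta> (braid_closure 4 (braid_of w))"

lemma scaled_alexander_cong:
  assumes "word_unit a = word_unit b" "local_move (crossings (braid_of a)) (crossings (braid_of b))"
  shows "scaled_alexander (u @ a @ v) = scaled_alexander (u @ b @ v)"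
  using alexander_isotopic[OF braid_closure_local_move[OF assms(2), of 4 "braid_of u" "braid_of v"]] assms(1)
  by (simp add: scaled_alexander_def word_unit_append)

lemma hecke_trace_scaled_alexander: "hecke_trace (- t_half 2) scaled_alexander"
proof
  fix u v :: word4 and i
  let ?u = "braid_of u" and ?v = "braid_of v" and ?i = "gen_index i"
  let ?x = "t_half 1" and ?y = "t_half (-1)"
  have xx: "?x * ?x = t_half 2" and xy: "?x * ?y = 1"
    by (simp_all add: t_half_mult t_half_0)
  define N where "N = \<Delta> (braid_closure 4 (?u @ (?i, False) # ?v))"
  have P: "\<Delta> (braid_closure 4 (?u @ (?i, True) # ?v)) = N + (?x - ?y) * \<Delta> (braid_closure 4 (?u @ ?v))"
    using alexander_skein[of 4 ?u ?i ?v] by (simp add: N_def gen_index_bounds algebra_simps)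
  have "scaled_alexander (u @ (i, True) # v) + scaled_alexander (u @ (i, False) # v) =
      word_unit u * word_unit v * (- ?x * (?x - ?y)) * \<Delta> (braid_closure 4 (?u @ ?v))"
    unfolding scaled_alexander_def
    by (simp add: P N_def[symmetric] word_unit_def letter_unit_def algebra_simps)
  also have "- ?x * (?x - ?y) = 1 + - t_half 2"
    by (simp add: algebra_simps xx xy)
  finally show "scaled_alexander (u @ (i, True) # v) + scaled_alexander (u @ (i, False) # v) =
      (1 + - t_half 2) * scaled_alexander (u @ v)"
    by (simp add: scaled_alexander_def word_unit_append algebra_simps)
  have "\<Delta> (braid_closure 4 (?u @ [(?i, True), (?i, False)] @ ?v)) = \<Delta> (braid_closure 4 (?u @ [] @ ?v))"
    using local_move.R2[of True "?i - 1"]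
    by (intro alexander_isotopic braid_closure_local_move) (simp_all add: gen_index_bounds)
  moreover have "word_unit (u @ (i, True) # (i, False) # v) = - t_half 2 * word_unit (u @ v)"
    by (simp add: word_unit_def letter_unit_def xx[symmetric] algebra_simps)
  ultimately show "scaled_alexander (u @ (i, True) # (i, False) # v) = - t_half 2 * scaled_alexander (u @ v)"
    by (simp add: scaled_alexander_def)
  show "scaled_alexander (u @ [(S1, True), (S2, True), (S1, True)] @ v) =
      scaled_alexander (u @ [(S2, True), (S1, True), (S2, True)] @ v)"
    using local_move.R3[of True 0] by (intro scaled_alexander_cong) (simp_all add: word_unit_def letter_unit_def)
  show "scaled_alexander (u @ [(S2, True), (S3, True), (S2, True)] @ v) =
      scaled_alexander (u @ [(S3, True), (S2, True), (S3, True)] @ v)"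
    using local_move.R3[of True 1] by (intro scaled_alexander_cong)
      (simp_all add: word_unit_def letter_unit_def numeral_2_eq_2)
  show "scaled_alexander (u @ [(S1, True), (S3, True)] @ v) = scaled_alexander (u @ [(S3, True), (S1, True)] @ v)"
    using local_move.slide[of 0 0 "Cross True" "Cross True"] by (intro scaled_alexander_cong)
      (simp_all add: word_unit_def letter_unit_def numeral_2_eq_2)
  show "scaled_alexander (u @ v) = scaled_alexander (v @ u)"
    using alexander_rotate[of 4 ?u ?v] by (simp add: scaled_alexander_def word_unit_append mult.commute)
qed

text \<open>Three destabilizations, each possible for either sign, lead to the unknot.\<close>

lemma alexander_generator_product:
  "\<Delta> (braid_closure 4 [(1, a), (2, b), (3, c)]) = 1"
proof -
  have "\<Delta> (braid_closure 4 [(1, a), (2, b), (3, c)]) = \<Delta> (braid_closure 3 [(1, a), (2, b)])"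
    using alexander_stabilize[of 2 "[(1, a), (2, b)]" c] by (simp add: eval_nat_numeral)
  also have "\<dots> = \<Delta> (braid_closure 2 [(1, a)])"
    using alexander_stabilize[of 1 "[(1, a)]" b] by (simp add: eval_nat_numeral)
  also have "\<dots> = \<Delta> (braid_closure 1 [])"
    using alexander_stabilize[of 0 "[]" a] by (simp add: eval_nat_numeral)
  also have "\<dots> = 1"
    using \<Delta> by (simp add: alexander_polynomial_def braid_closure_def)
  finally show ?thesis .
qed

text \<open>The fourth strand is split off. A crossing joining it to the third can be removed by
  destabilization whatever its sign, so \<open>alexander_zero\<close> applies.\<close>

lemma alexander_split_12:
  assumes "on_strands 3 w"
  shows "\<Delta> (braid_closure 4 w) = 0"
proof -
  have "\<Delta> (braid_closure 4 (w @ [(3, c)])) = \<Delta> (braid_closure 3 w)" for c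
    using alexander_stabilize[of 2 w c] assms by (simp add: eval_nat_numeral)
  moreover have "on_strands 4 w"
    using assms by (auto simp: on_strands_def)
  ultimately show ?thesis
    using alexander_zero[of 4 w 3 "[]"] by simp
qed

lemma scaled_alexander_base:
  assumes "p \<in> {[], [S1], [S2], [S3], [S1, S2], [S1, S3], [S2, S3]}"
  shows "scaled_alexander (map (\<lambda>i. (i, True)) p) = 0"
proof -
  \<comment> \<open>In each remaining word a missing generator is inserted; destabilization gives
    the same value for both of its signs.\<close>
  have "\<Delta> (braid_closure 4 [(3, True)]) = 0"
  proof -
    have "\<Delta> (braid_closure 4 [(2, c), (3, True)]) = \<Delta> (braid_closure 2 [])" for c
      using alexander_stabilize[of 2 "[(2, c)]" True] alexander_stabilize[of 1 "[]" c]
      by (simp add: eval_nat_numeral)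
    then show ?thesis
      using alexander_zero[of 4 "[]" 2 "[(3, True)]"] by simp
  qed
  moreover have "\<Delta> (braid_closure 4 [(1, True), (3, True)]) = 0"
    using alexander_zero[of 4 "[(1, True)]" 2 "[(3, True)]"] by (simp add: alexander_generator_product[simplified])
  moreover have "\<Delta> (braid_closure 4 [(2, True), (3, True)]) = 0"
    using alexander_zero[of 4 "[]" 1 "[(2, True), (3, True)]"] by (simp add: alexander_generator_product[simplified])
  ultimately show ?thesis
    using assms by (auto simp: scaled_alexander_def alexander_split_12)
qed

text \<open>Two traces are compared, so the base words decide. On the product of all three
  generators the rescaled invariant is the cube of \<open>- t_half 1\<close>, whence
  \<open>t_half 3\<close> and the sign.\<close>

lemma scaled_alexander_burau:
  fixes s defines "s \<equiv> - t_half 2"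
  shows "(1 - s) * (1 + s\<^sup>2) * scaled_alexander w = - (t_half 3 * burau_trace s w)"
proof -
  let ?f = "\<lambda>w. (1 - s) * (1 + s\<^sup>2) * scaled_alexander w + t_half 3 * burau_trace s w"
  interpret hecke_trace s ?f
    using hecke_trace_linear[OF hecke_trace_scaled_alexander hecke_trace_burau_trace] unfolding s_def .
  have "?f w = 0"
  proof (rule vanish)
    fix p assume p: "p \<in> {[], [S1], [S2], [S3], [S1, S2], [S1, S3], [S2, S3], [S1, S2, S3]}"
    show "?f (map (\<lambda>i. (i, True)) p) = 0"
    proof (cases "p = [S1, S2, S3]")
      case True
      have "scaled_alexander [(S1, True), (S2, True), (S3, True)] = - t_half 3"
        by (simp add: scaled_alexander_def word_unit_def letter_unit_def t_half_mult
            alexander_generator_product[simplified])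
      then show ?thesis
        using True by (simp add: burau_trace_base algebra_simps)
    next
      case False
      then show ?thesis
        using p scaled_alexander_base[of p] by (auto simp: burau_trace_base burau_trace_single)
    qed
  qed
  then show ?thesis
    by (simp add: eq_neg_iff_add_eq_0)
qed

end

section \<open>Blocks modulo powers of the variable\<close>

lemma mat_mult_left_commute: "mat x ** (A ** B) = A ** (mat x ** B)" for A B :: "'a::comm_ring_1^'n^'n"
  unfolding mat_mult
  by (simp add: vec_eq_iff matrix_matrix_mult_def sum_distrib_left mult.left_commute)

lemma mat_mult_mat: "mat x ** (mat y ** (A :: 'a::comm_ring_1^'n^'n)) = mat (x * y) ** A"
  by (simp add: mat_mult vec_eq_iff mult.assoc)

lemma mat_mult_split: "mat (x * y) ** (A ** B) = (mat x ** A) ** (mat y ** B)"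
  for A B :: "'a::comm_ring_1^'n^'n"
  using mat_mult_left_commute[of y A B]
  by (simp only: mat_mult_mat[symmetric] matrix_mul_assoc[symmetric])

definition mcong :: "'a::comm_ring_1 \<Rightarrow> 'a^'n^'n \<Rightarrow> 'a^'n^'n \<Rightarrow> bool" where
  "mcong d A B \<longleftrightarrow> (\<forall>i j. d dvd A $ i $ j - B $ i $ j)"

lemma mcong_refl: "mcong d A A"
  by (simp add: mcong_def)

lemma mcong_mult:
  assumes "mcong d A A'" "mcong d B B'"
  shows "mcong d (A ** B) (A' ** B')"
  unfolding mcong_def
proof (intro allI)
  fix i j
  have "(A ** B) $ i $ j - (A' ** B') $ i $ j =
      (\<Sum>k\<in>UNIV. (A $ i $ k - A' $ i $ k) * B $ k $ j + A' $ i $ k * (B $ k $ j - B' $ k $ j))"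
    by (simp add: matrix_matrix_mult_def sum_subtractf[symmetric] algebra_simps)
  also have "d dvd \<dots>"
    using assms unfolding mcong_def by (intro dvd_sum dvd_add dvd_mult dvd_mult2) simp_all
  finally show "d dvd (A ** B) $ i $ j - (A' ** B') $ i $ j" .
qed

lemma mcong_trace: "mcong d A B \<Longrightarrow> d dvd trace A - trace B"
  by (simp add: mcong_def trace_def sum_subtractf[symmetric] dvd_sum)

lemma mcong_mat3:
  "mcong d (mat3 a b c e f g h k l) (mat3 a' b' c' e' f' g' h' k' l') \<longleftrightarrow>
    d dvd a - a' \<and> d dvd b - b' \<and> d dvd c - c' \<and> d dvd e - e' \<and> d dvd f - f' \<and> d dvd g - g' \<and>
    d dvd h - h' \<and> d dvd k - k' \<and> d dvd l - l'"
  by (simp add: mcong_def mat3_def forall_3 conj_assoc)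

text \<open>Up to division by \<open>1 - s\<close>, \<open>temperley s i\<close> is idempotent, so a
  letter acts by 1 and \<open>s\<close> on complementary summands and its powers are immediate. The
  factor \<open>1 - s\<close> clears the denominator.\<close>

lemma burau_replicate:
  "mat (1 - s) ** burau s (replicate k (i, c)) =
     (if c then mat (1 - s) - mat (1 - s ^ k) ** temperley s i
      else mat (s ^ k * (1 - s)) + mat (1 - s ^ k) ** temperley s i)"
proof (induction k)
  case 0
  show ?case by (cases i) (simp_all add: mat3_simps)
next
  case (Suc k)
  have "mat (1 - s) ** burau s (replicate (Suc k) (i, c)) =
      burau_letter s (i, c) ** (mat (1 - s) ** burau s (replicate k (i, c)))"
    by (simp add: mat_mult_left_commute[of _ "burau_letter s (i, c)"] del: burau_letter.simps)
  then show ?case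
    unfolding Suc.IH by (cases i; cases c) (simp_all add: mat3_simps algebra_simps)
qed

text \<open>The limit of the \<open>n\<close>-th power of a letter, multiplied by \<open>1 - s\<close>, in the \<open>s\<close>-adic topology.\<close>

definition burau_limit :: "'a::comm_ring_1 \<Rightarrow> gen \<Rightarrow> bool \<Rightarrow> 'a^3^3" where
  "burau_limit s i c = (if c then mat (1 - s) - temperley s i else temperley s i)"

lemma mcong_burau_replicate:
  assumes "k \<le> n"
  shows "mcong (s ^ k) (mat (1 - s) ** burau s (replicate n (i, c))) (burau_limit s i c)"
proof -
  have "s ^ k dvd s ^ n"
    using assms by (rule le_imp_power_dvd)
  moreover from this have "s ^ k dvd s ^ n - s * s ^ n" "s ^ k dvd s * s ^ n"
    by simp_all
  ultimately show ?thesis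
    unfolding burau_replicate burau_limit_def
    by (cases i; cases c) (simp_all add: mat3_simps mcong_mat3 algebra_simps)
qed

text \<open>The flag \<open>c\<close> is \<open>True\<close> for the blocks of the braid and
  \<open>False\<close> for their images under \<open>flip\<close>.\<close>

definition block :: "bool \<Rightarrow> nat \<Rightarrow> nat \<Rightarrow> nat \<Rightarrow> word4" where
  "block c p q r = replicate p (S1, c) @ replicate q (S2, \<not> c) @ replicate r (S3, c)"

definition block_limit :: "'a::comm_ring_1 \<Rightarrow> bool \<Rightarrow> 'a^3^3" where
  "block_limit s c = burau_limit s S1 c ** (burau_limit s S2 (\<not> c) ** burau_limit s S3 c)"

lemma mcong_block:
  assumes "k \<le> p" "k \<le> q" "k \<le> r"
  shows "mcong (s ^ k) (mat ((1 - s) ^ 3) ** burau s (block c p q r)) (block_limit s c)"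
proof -
  have "mat ((1 - s) ^ 3) ** burau s (block c p q r) =
      (mat (1 - s) ** burau s (replicate p (S1, c))) ** ((mat (1 - s) ** burau s (replicate q (S2, \<not> c))) **
         (mat (1 - s) ** burau s (replicate r (S3, c))))" (is "_ = ?A ** (?B ** ?C)")
    by (simp only: block_def burau_append power3_eq_cube mult.assoc mat_mult_split)
  also have "mcong (s ^ k) (?A ** (?B ** ?C)) (block_limit s c)"
    unfolding block_limit_def using assms by (intro mcong_mult mcong_burau_replicate)
  finally show ?thesis .
qed

text \<open>Among the three factors is a Temperley-Lieb matrix, at \<open>S2\<close> or at
  \<open>S1\<close> and \<open>S3\<close>. It has rank one, so the product has rank at most one and
  its square is its trace times itself.\<close>

lemma block_limit_square: "block_limit s c ** block_limit s c = mat (trace (block_limit s c)) ** block_limit s c"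
  by (cases c) (simp_all add: block_limit_def burau_limit_def mat3_simps algebra_simps)

text \<open>By the Temperley-Lieb relations the first value is
  \<open>(1 - s)^3 + 2 s (1 - s)\<close>. The second is minus the trace of
  \<open>e\<^sub>1 e\<^sub>2 e\<^sub>3\<close>, which vanishes because
  \<open>e\<^sub>3 e\<^sub>1 = 0\<close>.\<close>

lemma trace_block_limit: "trace (block_limit s c) = (if c then (1 - s) * (1 + s\<^sup>2) else 0)"
  by (cases c) (simp_all add: block_limit_def burau_limit_def mat3_simps algebra_simps power2_eq_square)

lemma trace_block_limit_power:
  "trace (((\<lambda>A. block_limit s c ** A) ^^ Suc n) (mat 1)) = trace (block_limit s c) ^ Suc n"
proof -
  have "((\<lambda>A. block_limit s c ** A) ^^ Suc n) (mat 1) = mat (trace (block_limit s c) ^ n) ** block_limit s c"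
  proof (induction n)
    case (Suc n)
    have "((\<lambda>A. block_limit s c ** A) ^^ Suc (Suc n)) (mat 1) =
        block_limit s c ** (mat (trace (block_limit s c) ^ n) ** block_limit s c)"
      using Suc.IH by simp
    also have "\<dots> = mat (trace (block_limit s c) ^ n) ** (block_limit s c ** block_limit s c)"
      by (rule mat_mult_left_commute[symmetric])
    also have "\<dots> = mat (trace (block_limit s c) ^ Suc n) ** block_limit s c"
      by (simp only: block_limit_square mat_mult_mat power_Suc2)
    finally show ?case .
  qed simp
  then show ?thesis
    by (simp add: trace_mat_mult mult.commute)
qed

definition blocks :: "bool \<Rightarrow> (nat \<Rightarrow> nat) \<Rightarrow> (nat \<Rightarrow> nat) \<Rightarrow> (nat \<Rightarrow> nat) \<Rightarrow> nat list \<Rightarrow> word4" where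
  "blocks c p q r js = concat (map (\<lambda>j. block c (p j) (q j) (r j)) js)"

lemma mcong_blocks:
  assumes "\<forall>j\<in>set js. k \<le> p j \<and> k \<le> q j \<and> k \<le> r j"
  shows "mcong (s ^ k) (mat ((1 - s) ^ (3 * length js)) ** burau s (blocks c p q r js))
           (((\<lambda>A. block_limit s c ** A) ^^ length js) (mat 1))"
  using assms
proof (induction js)
  case Nil
  then show ?case by (simp add: blocks_def mcong_refl)
next
  case (Cons j js)
  have "mat ((1 - s) ^ (3 * length (j # js))) ** burau s (blocks c p q r (j # js)) =
      (mat ((1 - s) ^ 3) ** burau s (block c (p j) (q j) (r j))) **
      (mat ((1 - s) ^ (3 * length js)) ** burau s (blocks c p q r js))"
    by (simp add: blocks_def burau_append power_add mat_mult_split)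
  then show ?case
    using Cons by (simp add: mcong_mult mcong_block)
qed

text \<open>A single block already contains at least \<open>k\<close> negative letters, so the
  trivial representation contributes 0 modulo \<open>s ^ k\<close>. Only the Burau trace remains,
  with its limit a power of the trace of one block.\<close>

lemma half_trace_blocks:
  assumes "\<forall>j\<in>set js. k \<le> p j \<and> k \<le> q j \<and> k \<le> r j" "js \<noteq> []"
  shows "s ^ k dvd (1 - s) ^ (3 * length js) * half_trace s (blocks c p q r js) +
           (if c then ((1 - s) * (1 + s\<^sup>2)) ^ length js else 0)"
proof -
  obtain j js' where js: "js = j # js'"
    using assms(2) by (cases js) auto
  have "k \<le> length (filter (\<lambda>a. \<not> snd a) (blocks c p q r js))"
    using assms(1) by (cases c) (simp_all add: js blocks_def block_def)
  then have "s ^ k dvd neg_weight s (blocks c p q r js)"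
    unfolding neg_weight_def by (rule le_imp_power_dvd)
  moreover have "s ^ k dvd (1 - s) ^ (3 * length js) * trace (burau s (blocks c p q r js)) -
       (if c then ((1 - s) * (1 + s\<^sup>2)) ^ length js else 0)"
    using mcong_trace[OF mcong_blocks[OF assms(1), of s c]] trace_block_limit_power[of "length js'" s c]
    by (simp add: js trace_mat_mult trace_block_limit split: if_splits)
  ultimately have "s ^ k dvd (1 - s) ^ (3 * length js) * neg_weight s (blocks c p q r js) -
      ((1 - s) ^ (3 * length js) * trace (burau s (blocks c p q r js)) -
       (if c then ((1 - s) * (1 + s\<^sup>2)) ^ length js else 0))"
    by (rule dvd_diff[OF dvd_mult])
  then show ?thesis
    by (simp add: half_trace_def right_diff_distrib algebra_simps)
qed

lemma flip_blocks: "flip (blocks c p q r js) = blocks (\<not> c) p q r js"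
  by (induction js) (simp_all add: blocks_def block_def flip_def)

lemma burau_trace_blocks:
  assumes "\<forall>j\<in>set js. k \<le> p j \<and> k \<le> q j \<and> k \<le> r j" "js \<noteq> []"
  shows "s ^ k dvd (1 - s) ^ (3 * length js) * burau_trace s (blocks True p q r js) +
           ((1 - s) * (1 + s\<^sup>2)) ^ length js"
  using dvd_diff[OF half_trace_blocks[OF assms, of s True] half_trace_blocks[OF assms, of s False]]
  by (simp add: burau_trace_def flip_blocks right_diff_distrib algebra_simps)

lemma braid_of_blocks: "braid_of (blocks True p q r [1..<Suc m]) = block_braid m p q r"
proof -
  have "braid_of (block True a b c) =
      sigma_power 1 (int a) @ sigma_power 2 (- int b) @ sigma_power 3 (int c)" for a b c
    by (auto simp: block_def sigma_power_def braid_of_def)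
  then show ?thesis
    by (simp add: block_braid_def blocks_def braid_of_def map_concat comp_def del: upt_Suc)
qed

section \<open>Change of the coefficient ring\<close>

definition map_mat :: "('a \<Rightarrow> 'b) \<Rightarrow> 'a^'n^'m \<Rightarrow> 'b^'n^'m" where
  "map_mat h A = (\<chi> i j. h (A $ i $ j))"

text \<open>Since \<open>t\<close> is a unit in the Laurent ring, congruences modulo powers of
  \<open>s\<close> say nothing there. They are established over \<open>int poly\<close>, and the
  traces are carried over by the substitution \<open>s = -t\<close>.\<close>

locale comm_ring_1_hom =
  fixes h :: "'a::comm_ring_1 \<Rightarrow> 'b::comm_ring_1"
  assumes h_1: "h 1 = 1" and h_add: "h (a + b) = h a + h b" and h_mult: "h (a * b) = h a * h b"
begin

lemma h_0: "h 0 = 0"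
  using h_add[of 0 0] by simp

lemma h_uminus: "h (- a) = - h a"
  using h_add[of a "- a"] by (simp add: h_0 eq_neg_iff_add_eq_0 add.commute)

lemma h_diff: "h (a - b) = h a - h b"
  using h_add[of a "- b"] by (simp add: h_uminus)

lemma h_power: "h (a ^ n) = h a ^ n"
  by (induction n) (simp_all add: h_1 h_mult)

lemma h_sum: "h (sum f A) = (\<Sum>a\<in>A. h (f a))"
  by (induction A rule: infinite_finite_induct) (simp_all add: h_0 h_add)

lemma map_mat_mult: "map_mat h (A ** B) = map_mat h A ** map_mat h B"
  by (simp add: map_mat_def matrix_matrix_mult_def vec_eq_iff h_sum h_mult)

lemma map_mat_mat3: "map_mat h (mat3 a b c d e f g k l) = mat3 (h a) (h b) (h c) (h d) (h e) (h f) (h g) (h k) (h l)"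
  by (simp add: map_mat_def mat3_def vec_eq_iff forall_3)

lemma map_mat_burau: "map_mat h (burau s w) = burau (h s) w"
proof (induction w)
  case Nil
  show ?case by (simp add: mat3_simps map_mat_mat3 h_0 h_1)
next
  case (Cons a w)
  obtain i c where a: "a = (i, c)" by (cases a)
  have "map_mat h (burau_letter s a) = burau_letter (h s) a"
    by (cases i; cases c) (simp_all add: a mat3_simps map_mat_mat3 h_0 h_1 h_add h_diff h_uminus)
  then show ?case
    using Cons by (simp add: map_mat_mult)
qed

lemma hom_half_trace: "h (half_trace s w) = half_trace (h s) w"
proof -
  have "h (trace (burau s w)) = trace (map_mat h (burau s w))"
    by (simp add: trace_def map_mat_def h_sum)
  then show ?thesis
    by (simp add: half_trace_def neg_weight_def h_diff h_power map_mat_burau)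
qed

lemma hom_burau_trace: "h (burau_trace s w) = burau_trace (h s) w"
  by (simp add: burau_trace_def h_diff hom_half_trace)

end

section \<open>Normalized forms\<close>

lemma lookup_single_times:
  "Poly_Mapping.lookup (Poly_Mapping.single k c * f) j = c * Poly_Mapping.lookup f (j - k)"
  for f :: "'a::ab_group_add \<Rightarrow>\<^sub>0 'b::comm_semiring_1"
proof -
  have "(\<Sum>q. Poly_Mapping.lookup f q when j = l + q) = Poly_Mapping.lookup f (j - l)" for l
  proof -
    have "j = l + q \<longleftrightarrow> q = j - l" for q
      by (auto simp: algebra_simps)
    then show ?thesis by simp
  qed
  then show ?thesis
    by (simp add: lookup_mult lookup_single when_mult)
qed

lemma lookup_t_half_mult: "Poly_Mapping.lookup (t_half k * f) j = Poly_Mapping.lookup f (j - k)"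
  by (simp add: t_half_def lookup_single_times)

lemma lookup_of_int_mult: "Poly_Mapping.lookup (of_int a * f) j = a * Poly_Mapping.lookup f j" for f :: laurent
  using lookup_single_times[of 0 a f j] by (simp flip: single_of_int)

definition laurent_of :: "int poly \<Rightarrow> laurent" where
  "laurent_of A = poly (map_poly of_int A) (- t_half 2)"

lemma laurent_of_0 [simp]: "laurent_of 0 = 0"
  by (simp add: laurent_of_def)

lemma laurent_of_pCons [simp]: "laurent_of (pCons a A) = of_int a - t_half 2 * laurent_of A"
  by (simp add: laurent_of_def map_poly_pCons)

lemma laurent_of_add: "laurent_of (A + B) = laurent_of A + laurent_of B"
proof (induction A arbitrary: B)
  case (pCons a A)
  then show ?case
    by (cases B) (simp add: algebra_simps)
qed simp

lemma laurent_of_smult: "laurent_of (smult c A) = of_int c * laurent_of A"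
  by (induction A) (simp_all add: algebra_simps)

lemma laurent_of_mult: "laurent_of (A * B) = laurent_of A * laurent_of B"
  by (induction A) (simp_all add: laurent_of_add laurent_of_smult algebra_simps)

interpretation laurent_of: comm_ring_1_hom laurent_of
  by unfold_locales (simp_all add: laurent_of_add laurent_of_mult one_pCons)

text \<open>The monomial \<open>s ^ i\<close> goes to \<open>(-1) ^ i\<close> times
  \<open>t ^ i\<close>, which has exponent \<open>2 * i\<close> in the square root of
  \<open>t\<close>.\<close>

lemma lookup_laurent_of:
  "Poly_Mapping.lookup (laurent_of A) j =
    (if j \<ge> 0 \<and> even j then (-1) ^ nat (j div 2) * coeff A (nat (j div 2)) else 0)"
proof (induction A arbitrary: j)
  case (pCons a A)
  have "Poly_Mapping.lookup (of_int a :: laurent) j = (if j = 0 then a else 0)"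
    by (simp add: lookup_of_int)
  moreover have "nat (j div 2) = Suc (nat ((j - 2) div 2))" if "j \<ge> 2"
    using that by linarith
  moreover have "j = 0 \<or> j \<ge> 2 \<or> j < 0 \<or> odd j"
    by presburger
  ultimately show ?case
    by (auto simp: lookup_minus lookup_t_half_mult pCons.IH coeff_pCons)
qed simp

lemma lookup_laurent_of_double: "Poly_Mapping.lookup (laurent_of A) (2 * int i) = (-1) ^ i * coeff A i"
  by (simp add: lookup_laurent_of)

lemma laurent_of_inject: "laurent_of A = laurent_of B \<longleftrightarrow> A = B"
proof
  assume "laurent_of A = laurent_of B"
  then have "(-1) ^ i * coeff A i = (-1) ^ i * coeff B i" for i
    using lookup_laurent_of_double by metis
  then show "A = B"
    by (intro poly_eqI) simp
qed simp

lemma laurent_of_range: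
  assumes "\<And>j. j < 0 \<or> odd j \<Longrightarrow> Poly_Mapping.lookup f j = 0"
  obtains A where "f = laurent_of A"
proof -
  let ?a = "\<lambda>i. (-1) ^ i * Poly_Mapping.lookup f (2 * int i)"
  \<comment> \<open>The finite support of \<open>f\<close> makes the coefficient sequence eventually
    zero, as \<open>Abs_poly\<close> requires.\<close>
  have "finite ((\<lambda>i. 2 * int i) -` {j. Poly_Mapping.lookup f j \<noteq> 0})"
    by (intro finite_vimageI finite_lookup) (simp add: inj_def)
  then have "MOST i. ?a i = 0"
    by (simp add: MOST_iff_cofinite vimage_def)
  then have a: "coeff (Abs_poly ?a) = ?a"
    by (simp add: Abs_poly_inverse)
  have "f = laurent_of (Abs_poly ?a)"
  proof (rule poly_mapping_eqI)
    fix j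
    show "Poly_Mapping.lookup f j = Poly_Mapping.lookup (laurent_of (Abs_poly ?a)) j"
    proof (cases "j \<ge> 0 \<and> even j")
      case True
      then have "j = 2 * int (nat (j div 2))" by auto
      then show ?thesis
        by (metis (no_types, lifting) a lookup_laurent_of_double mult.assoc left_minus_one_mult_self)
    next
      case False
      then show ?thesis
        using assms[of j] by (auto simp: lookup_laurent_of)
    qed
  qed
  then show ?thesis ..
qed

text \<open>An image of \<open>laurent_of\<close> has no negative or odd exponents. If
  \<open>f\<close> had one, the lowest such term would survive multiplication by
  \<open>laurent_of C\<close>, because \<open>C\<close> has constant term 1.\<close>

lemma laurent_of_div:
  assumes "laurent_of C * f = laurent_of P" and "coeff C 0 = 1"
  obtains A where "f = laurent_of A" "C * A = P"
proof -
  obtain C' where C: "C = pCons 1 C'"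
    using assms(2) by (cases C) simp
  \<comment> \<open>Multiplication by \<open>laurent_of C\<close> preserves the lowest of the exponents to be excluded.\<close>
  have zero: "Poly_Mapping.lookup f j = 0" if bad: "j < 0 \<or> odd j" for j
  proof (rule ccontr)
    let ?B = "{j. Poly_Mapping.lookup f j \<noteq> 0 \<and> (j < 0 \<or> odd j)}"
    assume "Poly_Mapping.lookup f j \<noteq> 0"
    then have ne: "?B \<noteq> {}" using bad by blast
    have fin: "finite ?B"
      using finite_lookup[of f] by (rule rev_finite_subset) auto
    define m where "m = Min ?B"
    have m: "Poly_Mapping.lookup f m \<noteq> 0" "m < 0 \<or> odd m"
      using Min_in[OF fin ne] by (auto simp: m_def)
    have below: "Poly_Mapping.lookup f i = 0" if "i < m" "i < 0 \<or> odd i" for i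
    proof (rule ccontr)
      assume "Poly_Mapping.lookup f i \<noteq> 0"
      then have "Min ?B \<le> i"
        using that(2) by (intro Min_le[OF fin]) blast
      then show False
        using that(1) by (simp add: m_def)
    qed
    have shift: "Poly_Mapping.lookup (laurent_of E * f) i = 0" if "i < m" "i < 0 \<or> odd i" for E i
      using that
    proof (induction E arbitrary: i)
      case (pCons a E)
      have "Poly_Mapping.lookup (of_int a * f) i = 0"
        using below[OF pCons.prems] by (simp add: lookup_of_int_mult)
      moreover have "Poly_Mapping.lookup (laurent_of E * f) (i - 2) = 0"
        using pCons.prems by (intro pCons.IH) auto
      ultimately show ?case
        by (simp add: left_diff_distrib lookup_minus mult.assoc lookup_t_half_mult)
    qed simp
    have "Poly_Mapping.lookup (laurent_of C * f) m = Poly_Mapping.lookup f m"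
      using shift[of "m - 2" C', OF _ disj_forward[OF m(2)]]
      by (simp add: C left_diff_distrib lookup_minus mult.assoc lookup_t_half_mult)
    moreover have "Poly_Mapping.lookup (laurent_of P) m = 0"
      using m(2) by (auto simp: lookup_laurent_of)
    ultimately show False
      using m(1) assms(1) by simp
  qed
  then obtain A where A: "f = laurent_of A"
    using laurent_of_range by blast
  then have "C * A = P"
    using assms(1) by (simp add: laurent_of_mult[symmetric] laurent_of_inject)
  with A that show ?thesis by blast
qed

text \<open>The nonzero constant terms fix the lowest exponent and with it the power of the square
  root of \<open>t\<close>; their positivity fixes the sign.\<close>

lemma normalized_form_unique:
  assumes "normalized_form f A" "normalized_form f B"
  shows "A = B"
proof -
  obtain k \<epsilon> where A: "coeff A 0 > 0" "\<epsilon> \<in> {1, -1}" "f = \<epsilon> * t_half k * laurent_of A"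
    using assms(1) unfolding normalized_form_def laurent_of_def by blast
  obtain l \<delta> where B: "coeff B 0 > 0" "\<delta> \<in> {1, -1}" "f = \<delta> * t_half l * laurent_of B"
    using assms(2) unfolding normalized_form_def laurent_of_def by blast
  obtain e :: int where e: "e \<in> {1, -1}" "\<And>j. Poly_Mapping.lookup f j = e * Poly_Mapping.lookup (laurent_of A) (j - k)"
    using A(2,3) that[of 1] that[of "-1"] by (auto simp: lookup_t_half_mult)
  obtain d :: int where d: "d \<in> {1, -1}" "\<And>j. Poly_Mapping.lookup f j = d * Poly_Mapping.lookup (laurent_of B) (j - l)"
    using B(2,3) that[of 1] that[of "-1"] by (auto simp: lookup_t_half_mult)
  have "Poly_Mapping.lookup (laurent_of B) (k - l) \<noteq> 0"
    using e(2)[of k] d(2)[of k] e(1) A(1) lookup_laurent_of_double[of A 0] by auto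
  moreover have "Poly_Mapping.lookup (laurent_of A) (l - k) \<noteq> 0"
    using e(2)[of l] d(2)[of l] d(1) B(1) lookup_laurent_of_double[of B 0] by auto
  ultimately have kl: "k = l"
    by (auto simp: lookup_laurent_of split: if_splits)
  have eq: "e * ((-1) ^ i * coeff A i) = d * ((-1) ^ i * coeff B i)" for i
    using e(2)[of "k + 2 * int i"] d(2)[of "k + 2 * int i"] kl by (simp add: lookup_laurent_of_double)
  have "e = d"
    using eq[of 0] e(1) d(1) A(1) B(1) by auto
  then show ?thesis
    using eq e(1) by (intro poly_eqI) auto
qed

section \<open>Coefficients of low order from a polynomial congruence\<close>

lemma monom_dvd_cancel:
  fixes E X :: "int poly"
  assumes "[:0, 1:] ^ k dvd E * X" "coeff E 0 = 1"
  shows "[:0, 1:] ^ k dvd X"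
proof -
  have *: "[:0, 1:] ^ k dvd Y \<longleftrightarrow> (\<forall>i<k. coeff Y i = 0)" for Y :: "int poly"
    using monom_1_dvd_iff'[of k Y] by (simp add: monom_altdef)
  have "coeff X i = 0" if "i < k" for i
    using that
  proof (induction i rule: less_induct)
    case (less i)
    have "0 = (\<Sum>j\<le>i. coeff E j * coeff X (i - j))"
      using assms(1) less.prems unfolding * by (simp add: coeff_mult)
    \<comment> \<open>By induction the lower coefficients of \<open>X\<close> vanish, so only the
      constant term of \<open>E\<close> contributes; in effect \<open>E\<close> is invertible as a
      power series.\<close>
    also have "\<dots> = (\<Sum>j\<in>{0}. coeff E j * coeff X (i - j))"
      using less by (intro sum.mono_neutral_right) auto
    finally show ?case
      using assms(2) by simp
  qed
  then show ?thesis
    by (simp add: *)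
qed

lemma coeff_one_minus_power:
  fixes n :: nat
  defines "P \<equiv> [:1, -1:] ^ n :: int poly"
  shows "coeff P 0 = 1" "coeff P 1 = - int n" "2 * coeff P 2 = int n * (int n - 1)"
    "6 * coeff P 3 = - (int n * (int n - 1) * (int n - 2))"
  unfolding P_def
  by (induction n) (simp_all add: coeff_pCons numeral_2_eq_2 numeral_3_eq_3 algebra_simps)

lemma coeff_one_plus_square_power:
  fixes n :: nat
  defines "P \<equiv> [:1, 0, 1:] ^ n :: int poly"
  shows "coeff P 0 = 1" "coeff P 1 = 0" "coeff P 2 = int n" "coeff P 3 = 0"
  unfolding P_def
  by (induction n) (simp_all add: coeff_pCons numeral_2_eq_2 numeral_3_eq_3)

lemma word_unit_cases: "word_unit w = t_half (int (length w)) \<or> word_unit w = - t_half (int (length w))"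
proof (induction w)
  case (Cons a w)
  then show ?case
    by (cases "snd a") (auto simp: word_unit_def letter_unit_def t_half_mult)
qed (simp add: word_unit_def t_half_0)

text \<open>The congruence fixes \<open>B\<close> modulo \<open>s ^ k\<close> as the expansion of
  \<open>(1 + s^2)^(m - 1) / (1 - s)^(2 m + 1)\<close>. Since the denominator has constant term 1,
  the coefficients are found in turn; the factor 3 keeps the last one integral.\<close>

lemma low_coefficients:
  fixes B :: "int poly"
  assumes dvd: "[:0, 1:] ^ k dvd [:1, -1:] ^ (2 * m + 1) * B - [:1, 0, 1:] ^ (m - 1)" and "m \<ge> 1"
  shows "k \<ge> 1 \<Longrightarrow> coeff B 0 = 1"
    and "k \<ge> 2 \<Longrightarrow> coeff B 1 = 2 * int m + 1"
    and "k \<ge> 3 \<Longrightarrow> coeff B 2 = 2 * int m ^ 2 + 4 * int m"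
    and "k \<ge> 4 \<Longrightarrow> 3 * coeff B 3 = 2 * int m * (2 * int m ^ 2 + 9 * int m + 4)"
proof -
  define P Q :: "int poly" where "P = [:1, -1:] ^ (2 * m + 1)" and "Q = [:1, 0, 1:] ^ (m - 1)"
  have "\<forall>i<k. coeff (P * B - Q) i = 0"
    using dvd monom_1_dvd_iff'[of k "P * B - Q"] by (simp add: monom_altdef P_def Q_def)
  then have low: "(\<Sum>j\<le>i. coeff P j * coeff B (i - j)) = coeff Q i" if "i < k" for i
    using that by (simp add: coeff_mult)
  have P: "coeff P 0 = 1" "coeff P 1 = - (2 * int m + 1)" "coeff P 2 = int m * (2 * int m + 1)"
    "3 * coeff P 3 = - (int m * (2 * int m + 1) * (2 * int m - 1))"
    using coeff_one_minus_power[of "2 * m + 1"] unfolding P_def[symmetric]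
    by (simp_all add: algebra_simps)
  have Q: "coeff Q 0 = 1" "coeff Q 1 = 0" "coeff Q 2 = int m - 1" "coeff Q 3 = 0"
    using coeff_one_plus_square_power[of "m - 1"] \<open>m \<ge> 1\<close> unfolding Q_def[symmetric]
    by (simp_all add: of_nat_diff)
  show 0: "coeff B 0 = 1" if "k \<ge> 1"
    using low[of 0] that P Q by simp
  show 1: "coeff B 1 = 2 * int m + 1" if "k \<ge> 2"
  proof -
    have "coeff B 1 + coeff P 1 = 0"
      using low[of 1] that P(1) Q 0 by simp
    then show ?thesis using P(2) by linarith
  qed
  show 2: "coeff B 2 = 2 * int m ^ 2 + 4 * int m" if "k \<ge> 3"
  proof -
    have "{..2::nat} = {0, 1, 2}" by auto
    then have "coeff B 2 + coeff P 1 * coeff B 1 + coeff P 2 * coeff B 0 = int m - 1"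
      using low[of 2] that P(1) Q by simp
    from this[unfolded P] show ?thesis
      using 0 1 that by (simp add: algebra_simps power2_eq_square)
  qed
  show "3 * coeff B 3 = 2 * int m * (2 * int m ^ 2 + 9 * int m + 4)" if "k \<ge> 4"
  proof -
    have "{..3::nat} = {0, 1, 2, 3}" by auto
    then have "coeff B 3 + coeff P 1 * coeff B 2 + coeff P 2 * coeff B 1 + coeff P 3 * coeff B 0 = 0"
      using low[of 3] that P(1) Q by simp
    then have "3 * coeff B 3 + 3 * (coeff P 1 * coeff B 2) + 3 * (coeff P 2 * coeff B 1) + 3 * coeff P 3 = 0"
      using 0 that by simp
    from this[unfolded P] show ?thesis
      using 1 2 that by (simp add: algebra_simps power2_eq_square)
  qed
qed

text \<open>A single \<open>B\<close> serves all admissible \<open>k\<close>. The exponent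
  \<open>2 * m + 1\<close> is \<open>3 * m\<close> from the blocks, plus 1 from \<open>C\<close>,
  minus \<open>m\<close> from the common factor that is cancelled.\<close>

lemma alexander_block_braid:
  assumes "alexander_polynomial \<Delta>" "m \<ge> 1"
  obtains B l \<epsilon> where "\<epsilon> \<in> {1, -1}"
    "\<Delta> (braid_closure 4 (block_braid m p q r)) = \<epsilon> * t_half l * laurent_of B"
    "\<And>k. \<forall>i\<in>{1..m}. k \<le> p i \<and> k \<le> q i \<and> k \<le> r i \<Longrightarrow>
       [:0, 1:] ^ k dvd [:1, -1:] ^ (2 * m + 1) * B - [:1, 0, 1:] ^ (m - 1)"
proof -
  let ?L = "braid_closure 4 (block_braid m p q r)"
  define w where "w = blocks True p q r [1..<Suc m]"
  define s :: "int poly" where "s = [:0, 1:]"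
  define C where "C = (1 - s) * (1 + s\<^sup>2)"
  have s: "laurent_of s = - t_half 2"
    by (simp add: s_def)
  have one_s: "1 - s = [:1, -1:]" "1 + s\<^sup>2 = [:1, 0, 1:]"
    by (simp_all add: s_def one_pCons power2_eq_square)
  define D where "D = scaled_alexander \<Delta> w"
  have unit: "t_half (- 3) * (t_half 3 * f) = f" "t_half 3 * (t_half (- 3) * f) = f" for f
    by (simp_all add: mult.assoc[symmetric] t_half_mult t_half_0)
  have "laurent_of C * D = - (t_half 3 * laurent_of (burau_trace s w))"
    using scaled_alexander_burau[OF assms(1), of w]
    by (simp add: C_def D_def laurent_of.h_mult laurent_of.h_diff laurent_of.h_add laurent_of.h_power
        laurent_of.h_1 s laurent_of.hom_burau_trace del: laurent_of_pCons)
  then have "laurent_of C * (t_half (- 3) * D) = t_half (- 3) * (t_half 3 * laurent_of (- burau_trace s w))"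
    by (simp add: mult.left_commute[of _ "t_half (- 3)"] laurent_of.h_uminus)
  then have "laurent_of C * (t_half (- 3) * D) = laurent_of (- burau_trace s w)"
    by (simp only: unit)
  \<comment> \<open>The constant term 1 of \<open>C\<close> brings the quotient back from the
    Laurent ring to \<open>int poly\<close>.\<close>
  then obtain B where B: "t_half (- 3) * D = laurent_of B" "C * B = - burau_trace s w"
    by (rule laurent_of_div) (simp add: C_def one_s)
  have D: "D = t_half 3 * laurent_of B"
    using unit(2)[of D] by (simp add: B(1))
  obtain \<epsilon> :: laurent where \<epsilon>: "\<epsilon> \<in> {1, -1}" "word_unit w = \<epsilon> * t_half (int (length w))"
    using word_unit_cases[of w] that[of 1] that[of "-1"] by auto
  have L: "\<Delta> ?L = \<epsilon> * t_half (3 - int (length w)) * laurent_of B"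
  proof -
    have "\<epsilon> * t_half (int (length w)) * \<Delta> ?L = t_half 3 * laurent_of B"
      using D \<epsilon>(2) by (simp only: D_def scaled_alexander_def[OF assms(1)] w_def braid_of_blocks)
    then have "\<epsilon> * t_half (- int (length w)) * (\<epsilon> * t_half (int (length w)) * \<Delta> ?L) =
        \<epsilon> * t_half (- int (length w)) * (t_half 3 * laurent_of B)"
      by simp
    moreover have "\<epsilon> * t_half (- int (length w)) * (\<epsilon> * t_half (int (length w)) * \<Delta> ?L) =
        (\<epsilon> * \<epsilon>) * (t_half (- int (length w)) * t_half (int (length w))) * \<Delta> ?L"
      by (simp only: ac_simps)
    moreover have "\<epsilon> * \<epsilon> = 1"
      using \<epsilon>(1) by auto
    moreover have "\<epsilon> * t_half (- int (length w)) * (t_half 3 * laurent_of B) =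
        \<epsilon> * (t_half 3 * t_half (- int (length w))) * laurent_of B"
      by (simp only: ac_simps)
    ultimately show ?thesis
      by (simp add: t_half_mult t_half_0)
  qed
  have "[:0, 1:] ^ k dvd [:1, -1:] ^ (2 * m + 1) * B - [:1, 0, 1:] ^ (m - 1)"
    if "\<forall>i\<in>{1..m}. k \<le> p i \<and> k \<le> q i \<and> k \<le> r i" for k
  proof -
    have "s ^ k dvd (1 - s) ^ (3 * length [1..<Suc m]) * burau_trace s w + ((1 - s) * (1 + s\<^sup>2)) ^ length [1..<Suc m]"
      unfolding w_def using that assms(2) by (intro burau_trace_blocks) auto
    then have "s ^ k dvd (1 - s) ^ (3 * m) * burau_trace s w + ((1 - s) * (1 + s\<^sup>2)) ^ m"
      by (simp del: upt_Suc)
    moreover have "burau_trace s w = - (C * B)"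
      using B(2) by simp
    moreover obtain n where n: "m = Suc n"
      using assms(2) by (cases m) auto
    \<comment> \<open>The factor split off here has constant term 1, so
      \<open>monom_dvd_cancel\<close> can remove it.\<close>
    have "(1 - s) ^ (3 * m) * (- (C * B)) + ((1 - s) * (1 + s\<^sup>2)) ^ m =
        - ((1 - s) ^ m * (1 + s\<^sup>2)) * ((1 - s) ^ (2 * m + 1) * B - (1 + s\<^sup>2) ^ (m - 1))"
    proof -
      have "(1 - s) ^ (3 * m) = (1 - s) ^ m * (1 - s) ^ (2 * m)"
        by (simp flip: power_add)
      moreover have "(1 + s\<^sup>2) ^ m = (1 + s\<^sup>2) * (1 + s\<^sup>2) ^ (m - 1)"
        by (simp add: n)
      ultimately show ?thesis
        unfolding C_def power_mult_distrib by (simp add: algebra_simps)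
    qed
    ultimately have "s ^ k dvd - ((1 - s) ^ m * (1 + s\<^sup>2)) * ((1 - s) ^ (2 * m + 1) * B - (1 + s\<^sup>2) ^ (m - 1))"
      by simp
    then have "s ^ k dvd ((1 - s) ^ m * (1 + s\<^sup>2)) * ((1 - s) ^ (2 * m + 1) * B - (1 + s\<^sup>2) ^ (m - 1))"
      by simp
    moreover have "coeff ((1 - s) ^ m * (1 + s\<^sup>2)) 0 = 1"
      by (simp add: one_s coeff_mult coeff_one_minus_power(1))
    ultimately have "s ^ k dvd (1 - s) ^ (2 * m + 1) * B - (1 + s\<^sup>2) ^ (m - 1)"
      by (rule monom_dvd_cancel[folded s_def])
    then show ?thesis
      unfolding one_s unfolding s_def .
  qed
  from that[OF \<epsilon>(1) L this] show ?thesis .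
qed

theorem theorem5p1:
  fixes \<Delta> :: "slice list \<Rightarrow> laurent" and m :: nat and p q r :: "nat \<Rightarrow> nat"
  assumes "alexander_polynomial \<Delta>"
    and "m \<ge> 1"
    and "\<forall>i\<in>{1..m}. p i > 0 \<and> q i > 0 \<and> r i > 0"
  defines "L \<equiv> braid_closure 4 (block_braid m p q r)"
  shows "(\<exists>A. normalized_form (\<Delta> L) A) \<and>
    (\<forall>A. normalized_form (\<Delta> L) A \<longrightarrow>
      ((\<forall>i\<in>{1..m}. p i > 1 \<and> q i > 1 \<and> r i > 1) \<longrightarrow>
         coeff A 0 = 1 \<and> coeff A 1 = 2 * int m + 1) \<and>
      ((\<forall>i\<in>{1..m}. p i > 2 \<and> q i > 2 \<and> r i > 2) \<longrightarrow>
         coeff A 2 = 2 * int m ^ 2 + 4 * int m) \<and>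
      ((\<forall>i\<in>{1..m}. p i > 3 \<and> q i > 3 \<and> r i > 3) \<longrightarrow>
         rat_of_int (coeff A 3) = 2 / 3 * of_nat m * (2 * of_nat m ^ 2 + 9 * of_nat m + 4)))"
proof -
  obtain B l \<epsilon> where \<epsilon>: "\<epsilon> \<in> {1, -1}" and L: "\<Delta> L = \<epsilon> * t_half l * laurent_of B"
    and dvd: "\<And>k. \<forall>i\<in>{1..m}. k \<le> p i \<and> k \<le> q i \<and> k \<le> r i \<Longrightarrow>
       [:0, 1:] ^ k dvd [:1, -1:] ^ (2 * m + 1) * B - [:1, 0, 1:] ^ (m - 1)"
    by (rule alexander_block_braid[OF assms(1,2), of p q r, folded L_def]) (rule that)
  note low = low_coefficients[OF dvd assms(2)]
  \<comment> \<open>Positive exponents are the case \<open>k = 1\<close>; the resulting constant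
    term 1 shows that \<open>B\<close> is already normalized.\<close>
  have "coeff B 0 = 1"
    using assms(3) by (intro low(1)[of 1]) (auto simp: Suc_le_eq)
  then have B: "normalized_form (\<Delta> L) B"
    unfolding normalized_form_def using \<epsilon> L[unfolded laurent_of_def] by (intro conjI exI[of _ l] bexI[of _ \<epsilon>]) simp_all
  have 1: "coeff B 1 = 2 * int m + 1" if "\<forall>i\<in>{1..m}. p i > 1 \<and> q i > 1 \<and> r i > 1"
    using that by (intro low(2)[of 2]) (auto simp: Suc_le_eq)
  have 2: "coeff B 2 = 2 * int m ^ 2 + 4 * int m" if "\<forall>i\<in>{1..m}. p i > 2 \<and> q i > 2 \<and> r i > 2"
    using that by (intro low(3)[of 3]) (auto simp: Suc_le_eq)
  have 3: "rat_of_int (coeff B 3) = 2 / 3 * of_nat m * (2 * of_nat m ^ 2 + 9 * of_nat m + 4)"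
    if "\<forall>i\<in>{1..m}. p i > 3 \<and> q i > 3 \<and> r i > 3"
  proof -
    have "3 * coeff B 3 = 2 * int m * (2 * int m ^ 2 + 9 * int m + 4)"
      using that by (intro low(4)[of 4]) (auto simp: Suc_le_eq)
    then have "rat_of_int (3 * coeff B 3) = rat_of_int (2 * int m * (2 * int m ^ 2 + 9 * int m + 4))"
      by (rule arg_cong)
    then show ?thesis
      by simp
  qed
  show ?thesis
  proof (intro conjI exI allI impI)
    show "normalized_form (\<Delta> L) B" by (rule B)
  next
    fix A assume "normalized_form (\<Delta> L) A"
    then have A: "A = B"
      using B by (rule normalized_form_unique)
    show "coeff A 0 = 1"
      unfolding A by fact
    show "coeff A 1 = 2 * int m + 1" if "\<forall>i\<in>{1..m}. p i > 1 \<and> q i > 1 \<and> r i > 1"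
      unfolding A using that by (rule 1)
    show "coeff A 2 = 2 * int m ^ 2 + 4 * int m" if "\<forall>i\<in>{1..m}. p i > 2 \<and> q i > 2 \<and> r i > 2"
      unfolding A using that by (rule 2)
    show "rat_of_int (coeff A 3) = 2 / 3 * of_nat m * (2 * of_nat m ^ 2 + 9 * of_nat m + 4)"
      if "\<forall>i\<in>{1..m}. p i > 3 \<and> q i > 3 \<and> r i > 3"
      unfolding A using that by (rule 3)
  qed
qed

end
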